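(* Let $H$ be an infinite-dimensional separable complex Hilbert space and let $\mathbb{X}$ be a topological space with at most countably many connected components. Let $\mathcal{T}\in\mathcal{C}(\mathbb{X},L(H))$ be a normal family, i.e. $\mathcal{T}_x$ is a normal operator for every $x\in\mathbb{X}$. Then $\mathcal{T}$ satisfies Weyl's theorem, that is, $\sigma_W(\mathcal{T})=\sigma(\mathcal{T})\setminus E_0(\mathcal{T})$.
   Context: $L(H)$ is the algebra of bounded linear operators on $H$ with the norm topology, and $\mathcal{C}(\mathbb{X},L(H))$ is the unital algebra (pointwise operations) of continuous maps $\mathcal{T}:\mathbb{X}\to L(H)$, $x\mapsto\mathcal{T}_x$, with unit the constant family $\mathcal{I}_x=I_H$. The spectrum $\sigma(\mathcal{T})$ is the set of $\lambda\in\mathbb{C}$ such that $\mathcal{T}-\lambda\mathcal{I}$ is not invertible in $\mathcal{C}(\mathbb{X},L(H))$. An operator $T\in L(H)$ is Fredholm if $\dim N(T)$ and $\mathrm{codim}\,R(T)$ are finite; $ind(T)=\dim N(T)-\mathrm{codim}\,R(T)$. A family $\mathcal{T}\in\mathcal{C}(\mathbb{X},L(H))$ is a Fredholm family if every $\mathcal{T}_x$ is Fredholm; its index is then $ind(\mathcal{T})=(ind(\mathcal{T}_x))_{\overline{x}\in\mathbb{X}^c}\in\mathbb{Z}^{n_c}$, where $\mathbb{X}^c$ is the set of connected components of $\mathbb{X}$, $n_c$ its cardinality, and $\overline{x}$ the component of $x$ (the value $ind(\mathcal{T}_x)$ depends only on $\overline{x}$). $\mathcal{T}$ is a Weyl family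 if it is a Fredholm family of index $0$ in $\mathbb{Z}^{n_c}$, and $\sigma_W(\mathcal{T})=\{\lambda\in\mathbb{C}:\mathcal{T}-\lambda\mathcal{I}\text{ is not a Weyl family}\}$. For $T\in L(H)$, $E_0(T)$ is the set of eigenvalues of $T$ of finite multiplicity (i.e. $0<\dim N(T-\lambda I)<\infty$) that are isolated points of $\sigma(T)$. For a family, $$E_0(\mathcal{T})=\Big\{\lambda\in\sigma(\mathcal{T}) : \exists A\subset\mathbb{X},\ A\neq\emptyset,\ \lambda\in\bigcap_{x\in A}E_0(\mathcal{T}_x),\ \lambda\notin\bigcup_{x\in\mathbb{X}\setminus A}\sigma(\mathcal{T}_x)\Big\}.$$ *)

theory Defs
  imports "HOL-Analysis.Analysis"
begin

section \<open>Complex Hilbert spaces\<close>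

text \<open>
  The underlying real Banach space is the library's (\<^class>\<open>banach\<close>); the class adds the
  complex scalar multiplication extending the real one, and an inner product, linear in its
  first argument, that induces the norm.
\<close>

class complex_hilbert_space = banach +
  fixes scaleC :: "complex \<Rightarrow> 'a \<Rightarrow> 'a"  (infixr \<open>*\<^sub>C\<close> 75)
    and cinner :: "'a \<Rightarrow> 'a \<Rightarrow> complex"
  assumes scaleC_of_real: "complex_of_real r *\<^sub>C x = r *\<^sub>R x"
    and scaleC_add_right: "a *\<^sub>C (x + y) = a *\<^sub>C x + a *\<^sub>C y"
    and scaleC_add_left: "(a + b) *\<^sub>C x = a *\<^sub>C x + b *\<^sub>C x"
    and scaleC_scaleC: "a *\<^sub>C (b *\<^sub>C x) = (a * b) *\<^sub>C x"
    and cinner_commute: "cinner x y = cnj (cinner y x)"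
    and cinner_add_left: "cinner (x + y) z = cinner x z + cinner y z"
    and cinner_scaleC_left: "cinner (a *\<^sub>C x) y = a * cinner x y"
    and cinner_self: "cinner x x = complex_of_real ((norm x)\<^sup>2)"

lemma scaleC_one: "1 *\<^sub>C x = (x :: 'a::complex_hilbert_space)"
  using scaleC_of_real[of 1 x] by simp

global_interpretation complex_vector: vector_space "scaleC :: complex \<Rightarrow> 'a \<Rightarrow> 'a::complex_hilbert_space"
  defines cspan = complex_vector.span
    and cdim = complex_vector.dim
  by unfold_locales (simp_all add: scaleC_add_right scaleC_add_left scaleC_scaleC scaleC_one)

lemma norm_scaleC: "norm (a *\<^sub>C x) = cmod a * norm (x :: 'a::complex_hilbert_space)"
proof -
  have "cinner x (a *\<^sub>C x) = cnj (a * cinner x x)"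
    by (metis cinner_commute cinner_scaleC_left)
  then have "cinner (a *\<^sub>C x) (a *\<^sub>C x) = (a * cnj a) * cinner x x"
    by (simp only: cinner_scaleC_left) (simp add: cinner_self)
  also have "a * cnj a = complex_of_real ((cmod a)\<^sup>2)"
    by (simp only: complex_norm_square)
  finally have "complex_of_real ((norm (a *\<^sub>C x))\<^sup>2) = complex_of_real ((cmod a * norm x)\<^sup>2)"
    by (simp add: cinner_self power_mult_distrib)
  then have "(norm (a *\<^sub>C x))\<^sup>2 = (cmod a * norm x)\<^sup>2"
    by (simp only: of_real_eq_iff)
  then show ?thesis
    by (simp add: power2_eq_iff_nonneg)
qed

definition cfinite_dim :: "'a::complex_hilbert_space set \<Rightarrow> bool"
  where "cfinite_dim V \<longleftrightarrow> (\<exists>B. finite B \<and> V \<subseteq> cspan B)"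

text \<open>
  \<open>basis_mod R B\<close> says that the cosets \<open>b + R\<close>, \<open>b \<in> B\<close>, are pairwise distinct and form a
  (Hamel) basis of the quotient by the linear subspace \<open>R\<close>; the codimension of \<open>R\<close> is the
  cardinality of such a basis.  As with the library's \<open>dim\<close>, the number \<open>codim R\<close> is only
  meaningful when it is finite.
\<close>

definition basis_mod :: "'a::complex_hilbert_space set \<Rightarrow> 'a set \<Rightarrow> bool"
  where "basis_mod R B \<longleftrightarrow>
    (\<forall>F c. finite F \<and> F \<subseteq> B \<and> (\<Sum>b\<in>F. c b *\<^sub>C b) \<in> R \<longrightarrow> (\<forall>b\<in>F. c b = 0)) \<and>
    (\<forall>x. \<exists>F c. finite F \<and> F \<subseteq> B \<and> x - (\<Sum>b\<in>F. c b *\<^sub>C b) \<in> R)"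

definition cfinite_codim :: "'a::complex_hilbert_space set \<Rightarrow> bool"
  where "cfinite_codim R \<longleftrightarrow> (\<exists>B. finite B \<and> basis_mod R B)"

definition codim :: "'a::complex_hilbert_space set \<Rightarrow> nat"
  where "codim R = card (SOME B. basis_mod R B)"


section \<open>Bounded operators\<close>

text \<open>
  \<open>L(H)\<close> is the set of complex-linear elements of the library's space \<open>'h \<Rightarrow>\<^sub>L 'h\<close> of bounded
  real-linear maps, whose norm is the operator norm.
\<close>

definition bounded_ops :: "('h::complex_hilbert_space \<Rightarrow>\<^sub>L 'h) set"
  where "bounded_ops = {T. \<forall>a x. blinfun_apply T (a *\<^sub>C x) = a *\<^sub>C blinfun_apply T x}"

lift_definition scalar_op :: "complex \<Rightarrow> 'h::complex_hilbert_space \<Rightarrow>\<^sub>L 'h" is "\<lambda>a x. a *\<^sub>C x"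
proof
  fix a :: complex and x y :: 'h and r :: real
  show "a *\<^sub>C (x + y) = a *\<^sub>C x + a *\<^sub>C y"
    by (rule scaleC_add_right)
  show "a *\<^sub>C (r *\<^sub>R x) = r *\<^sub>R (a *\<^sub>C x)"
    by (simp add: scaleC_scaleC mult.commute flip: scaleC_of_real)
  show "\<exists>K. \<forall>x::'h. norm (a *\<^sub>C x) \<le> norm x * K"
    by (metis norm_scaleC mult.commute order_refl)
qed

definition null_space :: "('h::complex_hilbert_space \<Rightarrow>\<^sub>L 'h) \<Rightarrow> 'h set"
  where "null_space T = {x. T x = 0}"

definition op_invertible :: "('h::complex_hilbert_space \<Rightarrow>\<^sub>L 'h) \<Rightarrow> bool"
  where "op_invertible T \<longleftrightarrow>
    (\<exists>S\<in>bounded_ops. T o\<^sub>L S = id_blinfun \<and> S o\<^sub>L T = id_blinfun)"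

definition op_spectrum :: "('h::complex_hilbert_space \<Rightarrow>\<^sub>L 'h) \<Rightarrow> complex set"
  where "op_spectrum T = {\<mu>. \<not> op_invertible (T - scalar_op \<mu>)}"

definition fredholm :: "('h::complex_hilbert_space \<Rightarrow>\<^sub>L 'h) \<Rightarrow> bool"
  where "fredholm T \<longleftrightarrow>
    T \<in> bounded_ops \<and> cfinite_dim (null_space T) \<and> cfinite_codim (range (blinfun_apply T))"

definition fredholm_index :: "('h::complex_hilbert_space \<Rightarrow>\<^sub>L 'h) \<Rightarrow> int"
  where "fredholm_index T = int (cdim (null_space T)) - int (codim (range (blinfun_apply T)))"

definition hilbert_adjoint :: "('h::complex_hilbert_space \<Rightarrow>\<^sub>L 'h) \<Rightarrow> 'h \<Rightarrow>\<^sub>L 'h"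
  where "hilbert_adjoint T = (THE S. S \<in> bounded_ops \<and> (\<forall>x y. cinner (T x) y = cinner x (S y)))"

definition normal_op :: "('h::complex_hilbert_space \<Rightarrow>\<^sub>L 'h) \<Rightarrow> bool"
  where "normal_op T \<longleftrightarrow>
    T \<in> bounded_ops \<and> T o\<^sub>L hilbert_adjoint T = hilbert_adjoint T o\<^sub>L T"

definition op_E0 :: "('h::complex_hilbert_space \<Rightarrow>\<^sub>L 'h) \<Rightarrow> complex set"
  where "op_E0 T = {\<mu>. \<mu> isolated_in op_spectrum T \<and>
    null_space (T - scalar_op \<mu>) \<noteq> {0} \<and> cfinite_dim (null_space (T - scalar_op \<mu>))}"


section \<open>Continuous families of operators\<close>

text \<open>
  A family over the space \<open>X\<close> is a function whose values outside \<open>topspace X\<close> are irrelevant.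
\<close>

definition op_families :: "'x topology \<Rightarrow> ('x \<Rightarrow> 'h::complex_hilbert_space \<Rightarrow>\<^sub>L 'h) set"
  where "op_families X = {T. continuous_map X (top_of_set bounded_ops) T}"

definition family_shift ::
    "('x \<Rightarrow> 'h::complex_hilbert_space \<Rightarrow>\<^sub>L 'h) \<Rightarrow> complex \<Rightarrow> 'x \<Rightarrow> 'h \<Rightarrow>\<^sub>L 'h"
  where "family_shift T \<mu> = (\<lambda>x. T x - scalar_op \<mu>)"

definition family_invertible :: "'x topology \<Rightarrow> ('x \<Rightarrow> 'h::complex_hilbert_space \<Rightarrow>\<^sub>L 'h) \<Rightarrow> bool"
  where "family_invertible X T \<longleftrightarrow>
    (\<exists>S\<in>op_families X. \<forall>x\<in>topspace X. T x o\<^sub>L S x = id_blinfun \<and> S x o\<^sub>L T x = id_blinfun)"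

definition family_spectrum :: "'x topology \<Rightarrow> ('x \<Rightarrow> 'h::complex_hilbert_space \<Rightarrow>\<^sub>L 'h) \<Rightarrow> complex set"
  where "family_spectrum X T = {\<mu>. \<not> family_invertible X (family_shift T \<mu>)}"

definition fredholm_family :: "'x topology \<Rightarrow> ('x \<Rightarrow> 'h::complex_hilbert_space \<Rightarrow>\<^sub>L 'h) \<Rightarrow> bool"
  where "fredholm_family X T \<longleftrightarrow> T \<in> op_families X \<and> (\<forall>x\<in>topspace X. fredholm (T x))"

text \<open>
  The index of a Fredholm family is indexed by the connected components of \<open>X\<close>; its entry at
  a component \<open>C\<close> is the common value of the indices of the operators \<open>T x\<close>, \<open>x \<in> C\<close>.
\<close>

definition family_index ::
    "'x topology \<Rightarrow> ('x \<Rightarrow> 'h::complex_hilbert_space \<Rightarrow>\<^sub>L 'h) \<Rightarrow> 'x set \<Rightarrow> int"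
  where "family_index X T =
    (\<lambda>C\<in>connected_components_of X. THE n. \<forall>x\<in>C. fredholm_index (T x) = n)"

definition weyl_family :: "'x topology \<Rightarrow> ('x \<Rightarrow> 'h::complex_hilbert_space \<Rightarrow>\<^sub>L 'h) \<Rightarrow> bool"
  where "weyl_family X T \<longleftrightarrow>
    fredholm_family X T \<and> family_index X T = (\<lambda>C\<in>connected_components_of X. 0)"

definition weyl_spectrum :: "'x topology \<Rightarrow> ('x \<Rightarrow> 'h::complex_hilbert_space \<Rightarrow>\<^sub>L 'h) \<Rightarrow> complex set"
  where "weyl_spectrum X T = {\<mu>. \<not> weyl_family X (family_shift T \<mu>)}"

definition family_E0 :: "'x topology \<Rightarrow> ('x \<Rightarrow> 'h::complex_hilbert_space \<Rightarrow>\<^sub>L 'h) \<Rightarrow> complex set"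
  where "family_E0 X T = {\<mu> \<in> family_spectrum X T.
    \<exists>A \<subseteq> topspace X. A \<noteq> {} \<and> \<mu> \<in> (\<Inter>x\<in>A. op_E0 (T x)) \<and>
      \<mu> \<notin> (\<Union>x\<in>topspace X - A. op_spectrum (T x))}"

end

theory Submission
  imports Defs
begin

text \<open>For a normal operator \<open>S\<close> the null space is the orthogonal complement of the range, so \<open>S\<close> is
  Fredholm, automatically of index \<open>0\<close>, iff its null space is finite-dimensional and its range is
  closed. The range is closed iff \<open>0\<close> is not an accumulation point of the spectrum: one direction
  follows from Baire's theorem; for the other, a spectrum of \<open>S\<close> avoiding the circles of radius
  \<open>\<alpha> < r\<close> forces the spectrum of \<open>S'S\<close> (\<open>S'\<close> the adjoint) to avoid the interval \<open>]0, r\<^sup>2[\<close>, which gives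
  \<open>norm (S y) \<ge> r * norm y\<close> on the range of \<open>S\<close>. Hence \<open>T x - \<mu>\<close> is Fredholm iff it is invertible or
  \<open>\<mu>\<close> lies in \<open>E\<^sub>0\<close>, for each member of the family; invertibility of a family is pointwise because
  inversion is continuous.\<close>

section \<open>Hilbert space geometry\<close>

text \<open>The delicate point is closedness of the range at an isolated spectral value, where all
  that is given is invertibility of the shifts of \<open>S\<close> on a punctured disc. Compactness
  makes the lower bounds uniform on each circle, and a finite sum over roots of unity, in the role
  of a contour integral, converts them into a lower bound for \<open>S'S - \<alpha>\<^sup>2\<close>.
  The detour through \<open>S'S\<close> pays because this operator is symmetric: in a gap of its
  spectrum, a supremum argument with quadratic forms raises the lower bound at the centre to the
  full distance from the ends. The index is 0 because range and null space are complementary, so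
  that a basis of the null space is at the same time a basis modulo the range.\<close>

abbreviation csubspace :: "'a::complex_hilbert_space set \<Rightarrow> bool"
  where "csubspace \<equiv> complex_vector.subspace"

lemma cinner_add_right: "cinner x (y + z) = cinner x y + cinner x (z::'a::complex_hilbert_space)"
  by (metis cinner_add_left cinner_commute complex_cnj_add)

lemma cinner_scaleC_right: "cinner x (a *\<^sub>C y) = cnj a * cinner x (y::'a::complex_hilbert_space)"
  by (metis cinner_commute cinner_scaleC_left complex_cnj_mult)

lemma cinner_minus_left: "cinner (- x) y = - cinner x (y::'a::complex_hilbert_space)"
  using cinner_scaleC_left[of "-1" x y] by (simp add: complex_vector.scale_minus_left scaleC_one)

lemma cinner_minus_right: "cinner x (- y) = - cinner x (y::'a::complex_hilbert_space)"
  by (metis cinner_commute cinner_minus_left complex_cnj_minus)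

lemma cinner_diff_left: "cinner (x - y) z = cinner x z - cinner y (z::'a::complex_hilbert_space)"
  using cinner_add_left[of x "-y" z] by (simp add: cinner_minus_left)

lemma cinner_diff_right: "cinner x (y - z) = cinner x y - cinner x (z::'a::complex_hilbert_space)"
  using cinner_add_right[of x y "-z"] by (simp add: cinner_minus_right)

lemma cinner_zero_left [simp]: "cinner 0 (y::'a::complex_hilbert_space) = 0"
  using cinner_diff_left[of 0 0 y] by simp

lemma cinner_zero_right [simp]: "cinner (y::'a::complex_hilbert_space) 0 = 0"
  using cinner_diff_right[of y 0 0] by simp

lemma cinner_scaleR_left: "cinner (r *\<^sub>R x) y = of_real r * cinner x (y::'a::complex_hilbert_space)"
  by (simp add: cinner_scaleC_left flip: scaleC_of_real)

lemma cinner_scaleR_right: "cinner x (r *\<^sub>R y) = of_real r * cinner x (y::'a::complex_hilbert_space)"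
  by (simp add: cinner_scaleC_right flip: scaleC_of_real)

lemmas cinner_simps = cinner_add_left cinner_add_right cinner_diff_left cinner_diff_right
  cinner_minus_left cinner_minus_right cinner_scaleC_left cinner_scaleC_right
  cinner_scaleR_left cinner_scaleR_right

lemma cinner_sum_left: "cinner (\<Sum>i\<in>I. f i) y = (\<Sum>i\<in>I. cinner (f i) (y::'a::complex_hilbert_space))"
  by (induction I rule: infinite_finite_induct) (auto simp: cinner_add_left)

lemma cinner_sum_right: "cinner y (\<Sum>i\<in>I. f i) = (\<Sum>i\<in>I. cinner (y::'a::complex_hilbert_space) (f i))"
  by (induction I rule: infinite_finite_induct) (auto simp: cinner_add_right)

lemma cinner_self_eq_0_iff [simp]: "cinner x x = 0 \<longleftrightarrow> (x::'a::complex_hilbert_space) = 0"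
  by (simp add: cinner_self)

lemma cinner_eq_0_commute: "cinner x y = 0 \<longleftrightarrow> cinner y (x::'a::complex_hilbert_space) = 0"
  using cinner_commute[of x y] by (simp add: cinner_commute[of x y])

lemma power2_norm_eq_cinner: "(norm (x::'a::complex_hilbert_space))\<^sup>2 = Re (cinner x x)"
  by (simp add: cinner_self)

lemma Re_cinner_commute: "Re (cinner x y) = Re (cinner y (x::'a::complex_hilbert_space))"
  by (metis cinner_commute complex_cnj cnj.simps(1))

lemma power2_norm_add:
  "(norm (x + y :: 'a::complex_hilbert_space))\<^sup>2 = (norm x)\<^sup>2 + 2 * Re (cinner x y) + (norm y)\<^sup>2"
  using Re_cinner_commute[of x y] by (simp add: power2_norm_eq_cinner cinner_simps)

lemma power2_norm_diff:
  "(norm (x - y :: 'a::complex_hilbert_space))\<^sup>2 = (norm x)\<^sup>2 - 2 * Re (cinner x y) + (norm y)\<^sup>2"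
  using Re_cinner_commute[of x y] by (simp add: power2_norm_eq_cinner cinner_simps)

text \<open>Pythagoras for the projection of \<open>x\<close> onto the line through
  \<open>y\<close>. Nonnegativity of the left side gives Cauchy-Schwarz; and if no multiple of
  \<open>y\<close> can be subtracted to shorten \<open>x\<close>, the last term must vanish.\<close>

lemma power2_norm_residual:
  fixes x y :: "'a::complex_hilbert_space"
  assumes "y \<noteq> 0"
  shows "(norm (x - (cinner x y / cinner y y) *\<^sub>C y))\<^sup>2 = (norm x)\<^sup>2 - (cmod (cinner x y))\<^sup>2 / (norm y)\<^sup>2"
proof -
  have *: "cinner x y * cnj (cinner x y) = complex_of_real ((cmod (cinner x y))\<^sup>2)"
    by (simp only: complex_norm_square)
  have "Re (cinner x ((cinner x y / cinner y y) *\<^sub>C y)) = (cmod (cinner x y))\<^sup>2 / (norm y)\<^sup>2"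
  proof -
    have "cinner x ((cinner x y / cinner y y) *\<^sub>C y) = cinner x y * cnj (cinner x y) / complex_of_real ((norm y)\<^sup>2)"
      by (simp add: cinner_scaleC_right cinner_self)
    also have "\<dots> = complex_of_real ((cmod (cinner x y))\<^sup>2 / (norm y)\<^sup>2)"
      unfolding * by simp
    finally show ?thesis by (metis Re_complex_of_real)
  qed
  moreover have "(norm ((cinner x y / cinner y y) *\<^sub>C y))\<^sup>2 = (cmod (cinner x y))\<^sup>2 / (norm y)\<^sup>2"
  proof -
    have "norm ((cinner x y / cinner y y) *\<^sub>C y) = cmod (cinner x y) / norm y"
      using assms by (simp add: norm_scaleC norm_divide cinner_self norm_mult power2_eq_square)
    then show ?thesis by (simp add: power_divide)
  qed
  ultimately show ?thesis
    by (simp add: power2_norm_diff)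
qed

lemma norm_cinner_le: "cmod (cinner x y) \<le> norm x * norm (y::'a::complex_hilbert_space)"
proof (cases "y = 0")
  case False
  have "(cmod (cinner x y))\<^sup>2 / (norm y)\<^sup>2 \<le> (norm x)\<^sup>2"
    using power2_norm_residual[OF False, of x] zero_le_power2[of "norm (x - (cinner x y / cinner y y) *\<^sub>C y)"]
    by linarith
  then have "(cmod (cinner x y))\<^sup>2 \<le> (norm x * norm y)\<^sup>2"
    using False by (simp add: field_simps)
  then show ?thesis
    by (rule power2_le_imp_le) simp
qed simp

lemma bounded_linear_cinner_left: "bounded_linear (\<lambda>x. cinner x (y::'a::complex_hilbert_space))"
  by (rule bounded_linear_intro[where K = "norm y"])
    (simp_all add: cinner_simps scaleR_conv_of_real norm_cinner_le)

lemma bounded_linear_cinner_right: "bounded_linear (\<lambda>x. cinner (y::'a::complex_hilbert_space) x)"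
  by (rule bounded_linear_intro[where K = "norm y"])
    (use norm_cinner_le[of y] in \<open>simp_all add: cinner_simps scaleR_conv_of_real mult.commute\<close>)

lemmas continuous_on_cinner_left [continuous_intros] =
  bounded_linear.continuous_on[OF bounded_linear_cinner_left]

lemmas continuous_on_cinner_right [continuous_intros] =
  bounded_linear.continuous_on[OF bounded_linear_cinner_right]

lemma continuous_on_scaleC_left [continuous_intros]:
  fixes d :: "'a::complex_hilbert_space"
  assumes "continuous_on S f"
  shows "continuous_on S (\<lambda>x. f x *\<^sub>C d)"
proof -
  have "bounded_linear (\<lambda>a. a *\<^sub>C d)"
    by (rule bounded_linear_intro[where K = "norm d"])
      (simp_all add: scaleC_add_left norm_scaleC scaleR_conv_of_real flip: scaleC_of_real scaleC_scaleC)
  from bounded_linear.continuous_on[OF this assms] show ?thesis .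
qed

lemma csubspace_imp_subspace: "csubspace V \<Longrightarrow> subspace (V::'a::complex_hilbert_space set)"
  unfolding complex_vector.subspace_def subspace_def by (auto simp flip: scaleC_of_real)

section \<open>Orthogonal projections and closed spans\<close>

lemma orthogonal_projection_exists:
  fixes V :: "'a::complex_hilbert_space set"
  assumes V: "csubspace V" "closed V"
  obtains p where "p \<in> V" "\<And>v. v \<in> V \<Longrightarrow> cinner (x - p) v = 0"
proof -
  have ne: "V \<noteq> {}" using complex_vector.subspace_0[OF V(1)] by auto
  define d where "d = (INF v\<in>V. (norm (x - v))\<^sup>2)"
  have bdd: "bdd_below ((\<lambda>v. (norm (x - v))\<^sup>2) ` V)"
    by (rule bdd_belowI2[where m = 0]) simp
  have d: "d \<le> (norm (x - v))\<^sup>2" if "v \<in> V" for v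
    unfolding d_def using bdd that by (rule cINF_lower)
  have "\<exists>v\<in>V. (norm (x - v))\<^sup>2 < d + e" if "e > 0" for e
    using cINF_less_iff[OF ne bdd, of "d + e"] that by (simp add: d_def)
  then have "\<forall>n. \<exists>v\<in>V. (norm (x - v))\<^sup>2 < d + 1 / Suc n" by simp
  then obtain v where v: "\<And>n. v n \<in> V" "\<And>n. (norm (x - v n))\<^sup>2 < d + 1 / Suc n"
    by metis
  \<comment> \<open>The midpoint of \<open>v m\<close> and \<open>v n\<close> lies in
    \<open>V\<close>, so its squared distance from \<open>x\<close> is at least \<open>d\<close>; by
    the parallelogram law two nearly optimal points are then close.\<close>
  have para: "(norm (v m - v n))\<^sup>2 \<le> 2 / Suc m + 2 / Suc n" for m n
  proof -
    have "(1/2) *\<^sub>R (v m + v n) \<in> V"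
      using csubspace_imp_subspace[OF V(1)] v(1) by (simp add: subspace_add subspace_scale)
    from d[OF this] have "4 * d \<le> (norm (2 *\<^sub>R (x - (1/2) *\<^sub>R (v m + v n))))\<^sup>2"
      by (simp add: power_mult_distrib)
    also have "2 *\<^sub>R (x - (1/2) *\<^sub>R (v m + v n)) = (x - v m) + (x - v n)"
      by (simp add: algebra_simps scaleR_2)
    finally have "4 * d \<le> (norm ((x - v m) + (x - v n)))\<^sup>2" .
    moreover have "(norm (v m - v n))\<^sup>2 = (norm ((x - v n) - (x - v m)))\<^sup>2"
      by (simp add: algebra_simps)
    ultimately show ?thesis
      using v(2)[of m] v(2)[of n] Re_cinner_commute[of "x - v n" "x - v m"]
      unfolding power2_norm_add power2_norm_diff[of "x - v n"] by linarith
  qed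
  have "Cauchy v"
  proof (rule CauchyI)
    fix e :: real assume e: "e > 0"
    obtain M :: nat where M: "4 / e\<^sup>2 < real M" using reals_Archimedean2 by blast
    have "norm (v m - v n) < e" if "m \<ge> M" "n \<ge> M" for m n
    proof -
      have "2 / Suc m \<le> 2 / Suc M" "2 / Suc n \<le> 2 / Suc M"
        using that by (simp_all add: frac_le)
      moreover have "4 / Suc M < e\<^sup>2"
      proof -
        have "4 < e\<^sup>2 * real M" using M e by (simp add: field_simps)
        also have "\<dots> \<le> e\<^sup>2 * Suc M" using e by simp
        finally show ?thesis by (simp add: field_simps)
      qed
      ultimately have "(norm (v m - v n))\<^sup>2 < e\<^sup>2" using para[of m n] by linarith
      then show ?thesis using e by (simp add: power2_less_imp_less)
    qed
    then show "\<exists>M. \<forall>m\<ge>M. \<forall>n\<ge>M. norm (v m - v n) < e" by blast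
  qed
  then obtain p where p: "v \<longlonglongrightarrow> p" using Cauchy_convergent convergent_def by blast
  have pV: "p \<in> V" using closed_sequentially[OF V(2) v(1) p] .
  have "(\<lambda>n. (norm (x - v n))\<^sup>2) \<longlonglongrightarrow> (norm (x - p))\<^sup>2"
    by (intro tendsto_intros p)
  moreover have "(\<lambda>n. d + 1 / Suc n) \<longlonglongrightarrow> d + 0"
    by (intro tendsto_intros LIMSEQ_Suc lim_1_over_n)
  ultimately have "(norm (x - p))\<^sup>2 \<le> d + 0"
    by (rule LIMSEQ_le) (use v(2) in \<open>blast intro: less_imp_le\<close>)
  then have pd: "(norm (x - p))\<^sup>2 \<le> d" by simp
  \<comment> \<open>Moving \<open>p\<close> along \<open>w\<close> cannot push the squared distance
    below \<open>d\<close>, whereas the multiple \<open>?c\<close> lowers it by the subtracted term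
    of \<open>power2_norm_residual\<close>.\<close>
  have "cinner (x - p) w = 0" if w: "w \<in> V" for w
  proof (cases "w = 0")
    case False
    let ?c = "cinner (x - p) w / cinner w w"
    have "p + ?c *\<^sub>C w \<in> V"
      using V(1) pV w by (simp add: complex_vector.subspace_add complex_vector.subspace_scale)
    from d[OF this] have "d \<le> (norm ((x - p) - ?c *\<^sub>C w))\<^sup>2" by (simp add: algebra_simps)
    then have "(cmod (cinner (x - p) w))\<^sup>2 / (norm w)\<^sup>2 \<le> 0"
      using pd unfolding power2_norm_residual[OF False] by linarith
    then have "(cmod (cinner (x - p) w))\<^sup>2 \<le> 0" using False by (simp add: divide_le_0_iff)
    then show ?thesis by simp
  qed simp
  with pV show thesis by (rule that)
qed

text \<open>Replacing \<open>a\<close> by its component \<open>d\<close> orthogonal to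
  \<open>V\<close> leaves the span unchanged and makes the coefficient of \<open>d\<close>
  continuous in \<open>x\<close>. Membership then means that \<open>x\<close> lies in the preimage
  of \<open>V\<close> under a continuous map.\<close>

lemma closed_cspan_insert:
  fixes V :: "'a::complex_hilbert_space set"
  assumes V: "csubspace V" "closed V"
  shows "closed (cspan (insert a V))"
proof -
  obtain p where p: "p \<in> V" "\<And>v. v \<in> V \<Longrightarrow> cinner (a - p) v = 0"
    using orthogonal_projection_exists[OF V] by blast
  define d where "d = a - p"
  have sV: "cspan V = V" using V(1) by (simp add: complex_vector.span_eq_iff)
  show ?thesis
  proof (cases "d = 0")
    case True
    then have "insert a V = V" using p(1) by (auto simp: d_def)
    then show ?thesis using V(2) sV by metis
  next
    case False
    have eq: "cspan (insert a V) = {x. x - (cinner x d / cinner d d) *\<^sub>C d \<in> V}" (is "_ = ?W")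
    proof (intro set_eqI iffI)
      fix x assume "x \<in> cspan (insert a V)"
      then obtain k where k: "x - k *\<^sub>C a \<in> V"
        unfolding complex_vector.span_insert sV by auto
      define v where "v = x - k *\<^sub>C a + k *\<^sub>C p"
      have v: "v \<in> V" "x = v + k *\<^sub>C d"
        using k p(1) V(1) unfolding v_def d_def
        by (auto simp: complex_vector.subspace_add complex_vector.subspace_scale
            complex_vector.scale_right_diff_distrib)
      have "cinner v d = 0"
        using p(2)[OF v(1)] by (simp add: d_def cinner_eq_0_commute[of v])
      then have "cinner x d / cinner d d = k" using v False by (simp add: cinner_simps)
      then show "x \<in> ?W" using v by simp
    next
      fix x assume x: "x \<in> ?W"
      let ?k = "cinner x d / cinner d d"
      have "x - ?k *\<^sub>C a = (x - ?k *\<^sub>C d) - ?k *\<^sub>C p"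
        by (simp add: d_def complex_vector.scale_right_diff_distrib)
      also have "\<dots> \<in> V"
        using x p(1) V(1) by (auto intro!: complex_vector.subspace_diff complex_vector.subspace_scale)
      finally show "x \<in> cspan (insert a V)"
        unfolding complex_vector.span_insert sV by blast
    qed
    have "closed ((\<lambda>x. x - (cinner x d / cinner d d) *\<^sub>C d) -` V)"
      using V(2) by (intro closed_vimage continuous_intros) (use False in auto)
    then show ?thesis unfolding eq by (simp add: vimage_def)
  qed
qed

lemma closed_cspan_finite_Un:
  fixes V :: "'a::complex_hilbert_space set"
  assumes V: "csubspace V" "closed V" and "finite B"
  shows "closed (cspan (V \<union> B))"
  using \<open>finite B\<close>
proof (induction B)
  case empty
  show ?case using V by (metis complex_vector.span_eq_iff sup_bot_right)
next
  case (insert a B)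
  have "cspan (V \<union> insert a B) = cspan (insert a (cspan (V \<union> B)))"
    by (simp add: complex_vector.span_insert complex_vector.span_span)
  then show ?case using closed_cspan_insert[OF complex_vector.subspace_span insert.IH] by simp
qed

corollary closed_cspan_finite:
  fixes B :: "'a::complex_hilbert_space set"
  assumes "finite B"
  shows "closed (cspan B)"
proof -
  have "cspan ({0} \<union> B) = cspan B" 
    using complex_vector.span_insert_0 by simp
  then show ?thesis
    using closed_cspan_finite_Un[of "{0}" B] assms complex_vector.subspace_single_0 by simp
qed

section \<open>Orthogonal complements, Riesz representation and adjoints\<close>

definition orth :: "'a::complex_hilbert_space set \<Rightarrow> 'a set"
  where "orth V = {w. \<forall>v\<in>V. cinner v w = 0}"

lemma csubspace_orth: "csubspace (orth V)"
  by (auto simp: orth_def complex_vector.subspace_def cinner_simps)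

lemma closed_orth: "closed (orth V)"
proof -
  have "orth V = (\<Inter>v\<in>V. {w. cinner v w = 0})" by (auto simp: orth_def)
  then show ?thesis by (simp add: closed_Collect_eq continuous_intros)
qed

lemma orth_decompose:
  fixes V :: "'a::complex_hilbert_space set"
  assumes "csubspace V" "closed V"
  obtains p q where "x = p + q" "p \<in> V" "q \<in> orth V"
proof -
  obtain p where p: "p \<in> V" "\<And>v. v \<in> V \<Longrightarrow> cinner (x - p) v = 0"
    using orthogonal_projection_exists[OF assms] by blast
  then have "x - p \<in> orth V"
    by (auto simp: orth_def cinner_eq_0_commute[of _ "x - p"])
  then show thesis using p(1) that[of p "x - p"] by simp
qed

lemma riesz_representation:
  fixes f :: "'a::complex_hilbert_space \<Rightarrow> complex"
  assumes f: "bounded_linear f" and fC: "\<And>a x. f (a *\<^sub>C x) = a * f x"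
  obtains y where "\<And>x. f x = cinner x y"
proof (cases "\<forall>x. f x = 0")
  case True
  then show thesis using that[of 0] by simp
next
  case False
  then obtain x0 where x0: "f x0 \<noteq> 0" by blast
  interpret f: bounded_linear f by (rule f)
  let ?V = "{x. f x = 0}"
  have V: "csubspace ?V"
    by (auto simp: complex_vector.subspace_def f.add fC f.zero)
  have "closed ?V"
    by (intro closed_Collect_eq continuous_intros f.continuous_on)
  with V obtain p q where pq: "x0 = p + q" "p \<in> ?V" "q \<in> orth ?V"
    using orth_decompose by blast
  have fq: "f q \<noteq> 0" using x0 pq by (auto simp: f.add)
  then have q0: "q \<noteq> 0" by (auto simp: f.zero)
  have "f x = cinner x (cnj (f q / cinner q q) *\<^sub>C q)" for x
  proof -
    have "f (x - (f x / f q) *\<^sub>C q) = 0" using fq by (simp add: f.diff fC)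
    then have "cinner (x - (f x / f q) *\<^sub>C q) q = 0" using pq(3) by (auto simp: orth_def)
    then have "cinner x q = (f x / f q) * cinner q q" by (simp add: cinner_simps)
    then show ?thesis using fq q0 by (simp add: cinner_simps)
  qed
  then show thesis by (rule that)
qed

text \<open>The adjoint is a definite description and needs existence and uniqueness first. Riesz
  gives a value \<open>g y\<close> for each \<open>y\<close>; linearity follows by testing against
  all vectors, boundedness by testing against \<open>g y\<close> itself.\<close>

lemma hilbert_adjoint:
  fixes T :: "'h::complex_hilbert_space \<Rightarrow>\<^sub>L 'h"
  assumes T: "T \<in> bounded_ops"
  shows "hilbert_adjoint T \<in> bounded_ops" "cinner (T x) y = cinner x (hilbert_adjoint T y)"
proof -
  have "\<exists>z. \<forall>x. cinner (T x) y = cinner x z" for y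
  proof -
    have "bounded_linear (\<lambda>x. cinner (T x) y)"
      by (rule bounded_linear_compose[OF bounded_linear_cinner_left blinfun.bounded_linear_right])
    moreover have "cinner (T (a *\<^sub>C x)) y = a * cinner (T x) y" for a x
      using T by (simp add: bounded_ops_def cinner_simps)
    ultimately obtain z where "\<And>x. cinner (T x) y = cinner x z"
      by (rule riesz_representation[of "\<lambda>x. cinner (T x) y"]) blast
    then show ?thesis by blast
  qed
  then obtain g where g: "\<And>x y. cinner (T x) y = cinner x (g y)" by metis
  have ext: "u = v" if "\<And>x. cinner x u = cinner x (v::'h)" for u v
  proof -
    have "cinner (u - v) (u - v) = 0" using that[of "u - v"] by (simp add: cinner_diff_right)
    then show ?thesis by simp
  qed
  have gC: "g (a *\<^sub>C y) = a *\<^sub>C g y" for a y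
    by (rule ext) (simp add: cinner_simps flip: g)
  have "bounded_linear g"
  proof (rule bounded_linear_intro[where K = "norm T"])
    show "g (x + y) = g x + g y" for x y
      by (rule ext) (simp add: cinner_simps flip: g)
    show "g (r *\<^sub>R x) = r *\<^sub>R g x" for r x
      by (rule ext) (simp add: cinner_simps flip: g)
    show "norm (g y) \<le> norm y * norm T" for y
    proof (cases "g y = 0")
      case False
      have "(norm (g y))\<^sup>2 = cmod (cinner (T (g y)) y)"
        by (simp add: g cinner_self norm_power)
      also have "\<dots> \<le> norm (T (g y)) * norm y" by (rule norm_cinner_le)
      also have "\<dots> \<le> (norm T * norm (g y)) * norm y" by (intro mult_right_mono norm_blinfun) auto
      finally show ?thesis using False by (simp add: power2_eq_square mult_ac)
    qed simp
  qed
  then have "blinfun_apply (Blinfun g) = g" by (rule bounded_linear_Blinfun_apply)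
  then have G: "Blinfun g \<in> bounded_ops \<and> (\<forall>x y. cinner (T x) y = cinner x (Blinfun g y))"
    by (simp add: bounded_ops_def gC g)
  have "hilbert_adjoint T \<in> bounded_ops \<and> (\<forall>x y. cinner (T x) y = cinner x (hilbert_adjoint T y))"
    unfolding hilbert_adjoint_def
  proof (rule theI[of _ "Blinfun g"], rule G)
    fix S assume S: "S \<in> bounded_ops \<and> (\<forall>x y. cinner (T x) y = cinner x (S y))"
    show "S = Blinfun g"
    proof (rule blinfun_eqI, rule ext)
      fix x y show "cinner x (S y) = cinner x (Blinfun g y)" using S G by metis
    qed
  qed
  then show "hilbert_adjoint T \<in> bounded_ops" "cinner (T x) y = cinner x (hilbert_adjoint T y)"
    by auto
qed

section \<open>Normal operators and closed range\<close>

text \<open>Carrying the adjoint as a second operator keeps the description in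
  \<open>hilbert_adjoint\<close> out of later arguments: shifting \<open>S\<close> by
  \<open>\<mu>\<close> just shifts \<open>S'\<close> by \<open>cnj \<mu>\<close>.\<close>

definition normal_pair :: "('h::complex_hilbert_space \<Rightarrow>\<^sub>L 'h) \<Rightarrow> ('h \<Rightarrow>\<^sub>L 'h) \<Rightarrow> bool"
  where "normal_pair S S' \<longleftrightarrow> S \<in> bounded_ops \<and> S' \<in> bounded_ops \<and>
    (\<forall>x y. cinner (S x) y = cinner x (S' y)) \<and> (\<forall>x. S (S' x) = S' (S x))"

lemma normal_op_imp_normal_pair: "normal_op T \<Longrightarrow> normal_pair T (hilbert_adjoint T)"
  unfolding normal_op_def normal_pair_def using hilbert_adjoint[of T]
  by (metis blinfun_apply_blinfun_compose)

lemma scalar_op_in_bounded_ops: "scalar_op a \<in> bounded_ops"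
  by (simp add: bounded_ops_def scalar_op.rep_eq scaleC_scaleC mult.commute)

lemma bounded_ops_diff: "S \<in> bounded_ops \<Longrightarrow> T \<in> bounded_ops \<Longrightarrow> S - T \<in> bounded_ops"
  by (simp add: bounded_ops_def blinfun.diff_left complex_vector.scale_right_diff_distrib)

lemma bounded_ops_scaleC: "S \<in> bounded_ops \<Longrightarrow> S (a *\<^sub>C x) = a *\<^sub>C S x"
  by (simp add: bounded_ops_def)

lemma normal_pair_shift:
  assumes "normal_pair S S'"
  shows "normal_pair (S - scalar_op \<mu>) (S' - scalar_op (cnj \<mu>))"
  using assms unfolding normal_pair_def
  by (auto simp: bounded_ops_diff scalar_op_in_bounded_ops blinfun.diff_left blinfun.diff_right
      scalar_op.rep_eq cinner_simps bounded_ops_scaleC algebra_simps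
      complex_vector.scale_right_diff_distrib)

lemma csubspace_null_space: "S \<in> bounded_ops \<Longrightarrow> csubspace (null_space S)"
  by (auto simp: complex_vector.subspace_def null_space_def blinfun.add_right bounded_ops_scaleC)

lemma csubspace_image:
  assumes "S \<in> bounded_ops" "csubspace V"
  shows "csubspace (blinfun_apply S ` V)"
  unfolding complex_vector.subspace_def
proof (intro conjI ballI allI)
  show "0 \<in> blinfun_apply S ` V"
    using assms(2) by (force simp: complex_vector.subspace_def)
  fix x y assume "x \<in> blinfun_apply S ` V" "y \<in> blinfun_apply S ` V"
  then show "x + y \<in> blinfun_apply S ` V"
    using assms(2) by (force simp: complex_vector.subspace_def simp flip: blinfun.add_right)
next
  fix c x assume "x \<in> blinfun_apply S ` V"
  then show "c *\<^sub>C x \<in> blinfun_apply S ` V"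
    using assms by (force simp: complex_vector.subspace_def simp flip: bounded_ops_scaleC)
qed

section \<open>Lower bounds, closed images and inverses\<close>

lemma closed_image_bounded_below:
  assumes "csubspace V" "closed V" "c > 0" "\<And>x. x \<in> V \<Longrightarrow> c * norm x \<le> norm (blinfun_apply S x)"
  shows "closed (blinfun_apply S ` V)"
proof -
  have "complete (blinfun_apply S ` V)"
    using assms by (intro complete_isometric_image[of c])
      (auto simp: csubspace_imp_subspace blinfun.bounded_linear_right complete_eq_closed)
  then show ?thesis by (rule complete_imp_closed)
qed

lemma op_invertible_imp_bounded_below:
  assumes "op_invertible S"
  obtains c where "c > 0" "\<And>x. c * norm x \<le> norm (S x)"
proof -
  obtain G where G: "G o\<^sub>L S = id_blinfun" using assms by (auto simp: op_invertible_def)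
  \<comment> \<open>\<open>+ 1\<close> keeps the divisor positive on the zero space, where
    \<open>G = 0\<close>.\<close>
  have G0: "norm G + 1 > 0" using norm_ge_zero[of G] by linarith
  have "1 / (norm G + 1) * norm x \<le> norm (S x)" for x
  proof -
    have "norm x = norm (G (S x))" using G by (metis blinfun_apply_blinfun_compose blinfun_apply_id_blinfun)
    also have "\<dots> \<le> norm G * norm (S x)" by (rule norm_blinfun)
    also have "\<dots> \<le> (norm G + 1) * norm (S x)" by (simp add: mult_right_mono)
    finally show ?thesis
      using G0 by (simp add: pos_divide_le_eq mult.commute)
  qed
  moreover have "1 / (norm G + 1) > 0" using G0 by simp
  ultimately show thesis by (rule that[rotated])
qed

lemma norm_inverse_le:
  assumes "c > 0" "\<And>x. c * norm x \<le> norm (blinfun_apply S x)" "S o\<^sub>L G = id_blinfun"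
  shows "norm G \<le> 1 / c"
proof (rule norm_blinfun_bound)
  show "norm (G y) \<le> 1 / c * norm y" for y
    using assms(1) assms(2)[of "G y"] arg_cong[OF assms(3), of "\<lambda>T. blinfun_apply T y"]
    by (simp add: field_simps)
qed (use assms(1) in simp)

lemma op_invertible_if_surj_bounded_below:
  assumes S: "S \<in> bounded_ops" and c: "c > 0" "\<And>x. c * norm x \<le> norm (blinfun_apply S x)"
    and surj: "surj (blinfun_apply S)"
  shows "op_invertible S"
proof -
  define g where "g = inv (blinfun_apply S)"
  have Sg: "S (g y) = y" for y using surj by (simp add: g_def surj_f_inv_f)
  have inj: "x = y" if "S x = S y" for x y
  proof -
    have "c * norm (x - y) \<le> 0" using c(2)[of "x - y"] that by (simp add: blinfun.diff_right)
    then show ?thesis using c(1) by (simp add: mult_le_0_iff)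
  qed
  have "bounded_linear g"
  proof (rule bounded_linear_intro[where K = "1 / c"])
    show "norm (g y) \<le> norm y * (1 / c)" for y
      using c(1) c(2)[of "g y"] by (simp add: Sg field_simps)
    show "g (x + y) = g x + g y" for x y
      by (rule inj) (simp add: Sg blinfun.add_right)
    show "g (r *\<^sub>R x) = r *\<^sub>R g x" for r x
      by (rule inj) (simp add: Sg blinfun.scaleR_right)
  qed
  then have G: "blinfun_apply (Blinfun g) = g" by (rule bounded_linear_Blinfun_apply)
  have "g (a *\<^sub>C y) = a *\<^sub>C g y" for a y
    by (rule inj) (simp add: Sg bounded_ops_scaleC[OF S])
  then have "Blinfun g \<in> bounded_ops" by (simp add: bounded_ops_def G)
  moreover have "S o\<^sub>L Blinfun g = id_blinfun" "Blinfun g o\<^sub>L S = id_blinfun"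
    by (rule blinfun_eqI, simp add: G Sg inj[OF Sg])+
  ultimately show ?thesis unfolding op_invertible_def by blast
qed

text \<open>The projection \<open>\<pi>\<close> onto \<open>N\<close> along \<open>R\<close>
  identifies the quotient by \<open>R\<close> with \<open>N\<close>. The first part treats every
  basis modulo \<open>R\<close>, because \<open>codim\<close> picks one by \<open>SOME\<close>; the
  second supplies the existence that this choice requires.\<close>

lemma complementary_basis_mod_card:
  fixes N R :: "'a::complex_hilbert_space set"
  assumes N: "csubspace N" and R: "csubspace R"
    and disj: "\<And>x. x \<in> N \<Longrightarrow> x \<in> R \<Longrightarrow> x = 0"
    and sum: "\<And>x. \<exists>n\<in>N. x - n \<in> R"
  shows "basis_mod R B \<Longrightarrow> card B = cdim N"
    and "complex_vector.independent B \<Longrightarrow> B \<subseteq> N \<Longrightarrow> N \<subseteq> cspan B \<Longrightarrow> basis_mod R B"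
proof -
  obtain \<pi> where \<pi>: "\<And>x. \<pi> x \<in> N" "\<And>x. x - \<pi> x \<in> R" using sum by metis
  \<comment> \<open>Two candidates for the \<open>N\<close>-component of \<open>x\<close> differ by
    an element of both \<open>N\<close> and \<open>R\<close>.\<close>
  have \<pi>_eq: "\<pi> x = n" if "n \<in> N" "x - n \<in> R" for x n
  proof -
    have "\<pi> x - n \<in> N" using that N \<pi>(1) by (simp add: complex_vector.subspace_diff)
    moreover have "(x - n) - (x - \<pi> x) \<in> R"
      using that(2) R \<pi>(2) by (blast intro: complex_vector.subspace_diff)
    ultimately show ?thesis using disj[of "\<pi> x - n"] by simp
  qed
  have \<pi>_sum: "\<pi> (\<Sum>b\<in>F. c b *\<^sub>C b) = (\<Sum>b\<in>F. c b *\<^sub>C \<pi> b)" for F and c :: "'a \<Rightarrow> complex"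
  proof (rule \<pi>_eq)
    show "(\<Sum>b\<in>F. c b *\<^sub>C \<pi> b) \<in> N"
      using N \<pi>(1) by (intro complex_vector.subspace_sum complex_vector.subspace_scale)
    have "(\<Sum>b\<in>F. c b *\<^sub>C (b - \<pi> b)) \<in> R"
      using R \<pi>(2) by (intro complex_vector.subspace_sum complex_vector.subspace_scale)
    then show "(\<Sum>b\<in>F. c b *\<^sub>C b) - (\<Sum>b\<in>F. c b *\<^sub>C \<pi> b) \<in> R"
      by (simp add: complex_vector.scale_right_diff_distrib sum_subtractf)
  qed
  have \<pi>_0: "x \<in> R" if "\<pi> x = 0" for x using \<pi>(2)[of x] that by simp
  show "card B = cdim N" if B: "basis_mod R B"
  proof -
    have B1: "c b = 0" if "finite F" "F \<subseteq> B" "(\<Sum>b\<in>F. c b *\<^sub>C b) \<in> R" "b \<in> F" for F c b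
      using B that unfolding basis_mod_def by blast
    \<comment> \<open>Equal images of \<open>a\<close> and \<open>b\<close> would put
      \<open>a - b\<close> into \<open>R\<close>, a nontrivial relation modulo
      \<open>R\<close>.\<close>
    have inj: "inj_on \<pi> B"
    proof (rule inj_onI, rule ccontr)
      fix a b assume ab: "a \<in> B" "b \<in> B" "\<pi> a = \<pi> b" "a \<noteq> b"
      define c where "c = (\<lambda>x. if x = a then 1 else - 1 :: complex)"
      have "\<pi> (\<Sum>b\<in>{a, b}. c b *\<^sub>C b) = 0"
        unfolding \<pi>_sum using ab by (simp add: c_def scaleC_one complex_vector.scale_minus_left)
      from B1[OF _ _ \<pi>_0[OF this], of a] show False using ab by (simp add: c_def)
    qed
    have ind: "complex_vector.independent (\<pi> ` B)"
    proof
      assume "complex_vector.dependent (\<pi> ` B)"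
      then obtain U u v where U: "finite U" "U \<subseteq> \<pi> ` B" "v \<in> U" "u v \<noteq> 0"
        "(\<Sum>v\<in>U. u v *\<^sub>C v) = 0"
        unfolding complex_vector.dependent_explicit by blast
      obtain F where F: "F \<subseteq> B" "finite F" "U = \<pi> ` F"
        using finite_subset_image[OF U(1,2)] by blast
      have "inj_on \<pi> F" using inj F(1) by (rule inj_on_subset)
      then have "\<pi> (\<Sum>b\<in>F. u (\<pi> b) *\<^sub>C b) = 0"
        using U(5) unfolding F(3) \<pi>_sum by (simp add: sum.reindex)
      from B1[OF F(2,1) \<pi>_0[OF this]] show False using U(3,4) F(3) by auto
    qed
    have sp: "N \<subseteq> cspan (\<pi> ` B)"
    proof
      fix n assume n: "n \<in> N"
      obtain F c where F: "finite F" "F \<subseteq> B" "n - (\<Sum>b\<in>F. c b *\<^sub>C b) \<in> R"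
        using B unfolding basis_mod_def by blast
      have "\<pi> (\<Sum>b\<in>F. c b *\<^sub>C b) = n"
      proof (rule \<pi>_eq[OF n])
        show "(\<Sum>b\<in>F. c b *\<^sub>C b) - n \<in> R"
          using complex_vector.subspace_neg[OF R F(3)] by simp
      qed
      moreover have "(\<Sum>b\<in>F. c b *\<^sub>C \<pi> b) \<in> cspan (\<pi> ` B)"
        using F(2) by (intro complex_vector.span_sum complex_vector.span_scale complex_vector.span_base) auto
      ultimately show "n \<in> cspan (\<pi> ` B)" by (simp add: \<pi>_sum)
    qed
    have "card B = card (\<pi> ` B)" using inj by (simp add: card_image)
    also have "\<dots> = cdim N"
      using \<pi>(1) sp ind by (intro complex_vector.basis_card_eq_dim) auto
    finally show ?thesis .
  qed
  show "basis_mod R B" if ind: "complex_vector.independent B" and BN: "B \<subseteq> N" and sp: "N \<subseteq> cspan B"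
    unfolding basis_mod_def
  proof (intro conjI allI impI)
    fix F and c :: "'a \<Rightarrow> complex"
    assume F: "finite F \<and> F \<subseteq> B \<and> (\<Sum>b\<in>F. c b *\<^sub>C b) \<in> R"
    have "(\<Sum>b\<in>F. c b *\<^sub>C b) \<in> N"
      using F BN N by (intro complex_vector.subspace_sum complex_vector.subspace_scale) auto
    then have "(\<Sum>b\<in>F. c b *\<^sub>C b) = 0" using disj F by blast
    then show "\<forall>b\<in>F. c b = 0"
      using F complex_vector.independentD[OF ind] by auto
  next
    fix x
    have "\<pi> x \<in> cspan B" using \<pi>(1) sp by blast
    then obtain F c where "finite F" "F \<subseteq> B" "\<pi> x = (\<Sum>b\<in>F. c b *\<^sub>C b)"
      unfolding complex_vector.span_explicit by blast
    with \<pi>(2)[of x] have "finite F \<and> F \<subseteq> B \<and> x - (\<Sum>b\<in>F. c b *\<^sub>C b) \<in> R" by simp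
    then show "\<exists>F c. finite F \<and> F \<subseteq> B \<and> x - (\<Sum>b\<in>F. c b *\<^sub>C b) \<in> R" by blast
  qed
qed

text \<open>The spanning set in \<open>cfinite_dim\<close> may lie outside \<open>N\<close>; a
  maximal independent subset of \<open>N\<close> stays inside, and the exchange bound keeps it
  finite.\<close>

lemma cfinite_dim_basis:
  assumes "cfinite_dim N"
  obtains B where "finite B" "complex_vector.independent B" "B \<subseteq> N" "N \<subseteq> cspan B"
proof -
  obtain C where C: "finite C" "N \<subseteq> cspan C" using assms by (auto simp: cfinite_dim_def)
  obtain B where B: "B \<subseteq> N" "complex_vector.independent B" "N \<subseteq> cspan B"
    using complex_vector.maximal_independent_subset by blast
  have "finite B" using complex_vector.independent_span_bound[OF C(1) B(2)] B(1) C(2) by blast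
  with B show thesis using that by blast
qed

lemma fredholm_index_0_if_complementary:
  assumes S: "S \<in> bounded_ops" and fin: "cfinite_dim (null_space S)"
    and disj: "\<And>x. x \<in> null_space S \<Longrightarrow> x \<in> range S \<Longrightarrow> x = 0"
    and sum: "\<And>x. \<exists>n\<in>null_space S. x - n \<in> range S"
  shows "fredholm S" "fredholm_index S = 0"
proof -
  note comp = complementary_basis_mod_card[OF csubspace_null_space[OF S]
      csubspace_image[OF S complex_vector.subspace_UNIV] disj sum]
  obtain B where B: "finite B" "complex_vector.independent B" "B \<subseteq> null_space S" "null_space S \<subseteq> cspan B"
    using cfinite_dim_basis[OF fin] .
  have mod: "basis_mod (range S) B" using comp(2) B by blast
  then show "fredholm S" using S fin B(1) by (auto simp: fredholm_def cfinite_codim_def)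
  have "basis_mod (range S) (SOME B. basis_mod (range S) B)" using mod by (rule someI)
  then show "fredholm_index S = 0" using comp(1) by (simp add: fredholm_index_def codim_def)
qed

section \<open>Normal pairs: null space, range and Fredholm property\<close>

context
  fixes S S' :: "'h::complex_hilbert_space \<Rightarrow>\<^sub>L 'h"
  assumes pair: "normal_pair S S'"
begin

lemma normal_pair_bounded_ops: "S \<in> bounded_ops"
  using pair by (simp add: normal_pair_def)

lemma normal_pair_cinner: "cinner (S x) y = cinner x (S' y)"
  using pair by (simp add: normal_pair_def)

lemma normal_pair_cinner': "cinner (S' x) y = cinner x (S y)"
  by (metis cinner_commute normal_pair_cinner)

lemma normal_pair_commute: "S (S' x) = S' (S x)"
  using pair by (simp add: normal_pair_def)

lemma normal_pair_norm: "norm (S' x) = norm (S x)"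
proof -
  have "cinner (S' x) (S' x) = cinner (S x) (S x)"
    by (simp add: normal_pair_cinner normal_pair_cinner' normal_pair_commute)
  then have "(norm (S' x))\<^sup>2 = (norm (S x))\<^sup>2" by (simp add: power2_norm_eq_cinner)
  then show ?thesis by (simp add: power2_eq_iff_nonneg)
qed

text \<open>The complement of the range is the null space of the adjoint; normality enters through
  \<open>normal_pair_norm\<close>, by which \<open>S'\<close> and \<open>S\<close> have the same
  null space.\<close>

lemma orth_range: "orth (range S) = null_space S"
proof -
  have "w \<in> orth (range S) \<longleftrightarrow> S' w = 0" for w
  proof
    assume "w \<in> orth (range S)"
    then have "cinner (S' w) (S' w) = 0" by (auto simp: orth_def simp flip: normal_pair_cinner)
    then show "S' w = 0" by simp
  qed (auto simp: orth_def normal_pair_cinner)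
  moreover have "S' w = 0 \<longleftrightarrow> S w = 0" for w using normal_pair_norm[of w] by (metis norm_eq_zero)
  ultimately show ?thesis by (auto simp: null_space_def)
qed

lemma null_Int_range: "x \<in> null_space S \<Longrightarrow> x \<in> range S \<Longrightarrow> x = 0"
  unfolding orth_range[symmetric] orth_def using cinner_self_eq_0_iff[of x] by blast

lemma closed_range_complement:
  assumes "closed (range S)"
  shows "\<exists>n\<in>null_space S. x - n \<in> range S"
proof -
  obtain p q where "x = p + q" "p \<in> range S" "q \<in> orth (range S)"
    using orth_decompose[OF csubspace_image[OF normal_pair_bounded_ops complex_vector.subspace_UNIV] assms] .
  then show ?thesis unfolding orth_range by (intro bexI[of _ q]) auto
qed

text \<open>The lower bound makes the range closed and the null space trivial; as the latter is the
  orthogonal complement of the former, \<open>S\<close> is onto.\<close>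

lemma normal_bounded_below_imp_invertible:
  assumes c: "c > 0" "\<And>x. c * norm x \<le> norm (S x)"
  shows "op_invertible S"
proof (rule op_invertible_if_surj_bounded_below[OF normal_pair_bounded_ops c])
  have cl: "closed (range S)"
    using closed_image_bounded_below[OF complex_vector.subspace_UNIV closed_UNIV c] by blast
  have "x \<in> range S" for x
  proof -
    obtain n where n: "n \<in> null_space S" "x - n \<in> range S"
      using closed_range_complement[OF cl] by blast
    have "c * norm n \<le> 0" using c(2)[of n] n(1) by (simp add: null_space_def)
    then show ?thesis using n(2) c(1) by (simp add: mult_le_0_iff)
  qed
  then show "surj (blinfun_apply S)" by blast
qed

text \<open>The sets \<open>E k\<close> below exhaust the space, so by Baire's theorem one of them has interior points;
  being convex and symmetric, it then contains a ball around \<open>0\<close>.\<close>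

lemma bounded_below_on_orth:
  assumes F: "\<And>y. \<exists>z. \<exists>f\<in>F. y = S z + f"
  obtains c where "c > 0" "\<And>w. w \<in> orth F \<Longrightarrow> c * norm w \<le> norm (S w)"
proof -
  \<comment> \<open>The hypothesis says that the range and \<open>F\<close> together fill the space.
    For \<open>y = S z + f\<close> and \<open>w\<close> orthogonal to \<open>F\<close>, pairing
    \<open>y\<close> with \<open>w\<close> is pairing \<open>z\<close> with \<open>S' w\<close>,
    whose norm is \<open>norm (S w)\<close>; so every \<open>k\<close> above \<open>norm z\<close>
    puts \<open>y\<close> into \<open>E k\<close>.\<close>
  define E where "E k = {y. \<forall>w\<in>orth F. cmod (cinner y w) \<le> real k * norm (S w)}" for k
  have E_UNIV: "(\<Union>k. E k) = UNIV"
  proof -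
    have "\<exists>k. y \<in> E k" for y
    proof -
      obtain z f where zf: "f \<in> F" "y = S z + f" using F by blast
      obtain k where k: "norm z \<le> real k" using real_arch_simple by blast
      have "cmod (cinner y w) \<le> real k * norm (S w)" if "w \<in> orth F" for w
      proof -
        have "cinner y w = cinner z (S' w)"
          using that zf by (simp add: orth_def cinner_add_left normal_pair_cinner)
        then have "cmod (cinner y w) \<le> norm z * norm (S w)"
          using norm_cinner_le[of z "S' w"] by (simp add: normal_pair_norm)
        also have "\<dots> \<le> real k * norm (S w)" using k by (intro mult_right_mono) auto
        finally show ?thesis .
      qed
      then show ?thesis by (auto simp: E_def)
    qed
    then show ?thesis by auto
  qed
  have closed_E: "closed (E k)" for k
  proof -
    have "E k = (\<Inter>w\<in>orth F. {y. cmod (cinner y w) \<le> real k * norm (S w)})"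
      by (auto simp: E_def)
    moreover have "closed {y. cmod (cinner y w) \<le> real k * norm (S w)}" for w
      by (intro closed_Collect_le continuous_intros)
    ultimately show ?thesis by auto
  qed
  have "\<exists>k. interior (E k) \<noteq> {}"
  proof (rule ccontr)
    assume "\<not> ?thesis"
    then have "euclidean interior_of \<Union>(range E) = {}"
      using closed_E by (intro Baire_category_alt)
        (auto simp: completely_metrizable_space_euclidean)
    then show False by (simp add: E_UNIV)
  qed
  then obtain k y0 where "y0 \<in> interior (E k)" by blast
  then obtain e where e: "e > 0" "ball y0 e \<subseteq> E k" by (auto simp: mem_interior)
  \<comment> \<open>\<open>u\<close> is \<open>w\<close> rescaled to length \<open>e / 2\<close>; as
    a difference of two points of \<open>E k\<close> it satisfies the estimate with
    \<open>2 * k\<close>.\<close>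
  have bd: "(e / 2) * norm w \<le> (2 * real k) * norm (S w)" if w: "w \<in> orth F" for w
  proof (cases "w = 0")
    case False
    define u where "u = (e / (2 * norm w)) *\<^sub>R w"
    have "norm u < e" using e(1) False by (simp add: u_def)
    then have "y0 + u \<in> E k" "y0 \<in> E k" using e by (auto simp: dist_norm subset_iff)
    then have "cmod (cinner (y0 + u) w) \<le> real k * norm (S w)" "cmod (cinner y0 w) \<le> real k * norm (S w)"
      using w by (auto simp: E_def)
    moreover have "cinner u w = cinner (y0 + u) w - cinner y0 w" by (simp add: cinner_simps)
    ultimately have "cmod (cinner u w) \<le> (2 * real k) * norm (S w)"
      using norm_triangle_ineq4[of "cinner (y0 + u) w" "cinner y0 w"] by simp
    moreover have "cmod (cinner u w) = (e / 2) * norm w"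
      using False e(1) by (simp add: u_def cinner_simps cinner_self norm_mult norm_power power2_eq_square)
    ultimately show ?thesis by simp
  qed simp
  show thesis
  \<comment> \<open>\<open>k + 1\<close> in place of \<open>k\<close> avoids a zero divisor when
    \<open>k = 0\<close>.\<close>
  proof (rule that[of "e / (4 * (real k + 1))"])
    show "e / (4 * (real k + 1)) > 0" using e(1) by simp
    fix w assume "w \<in> orth F"
    note bd[OF this]
    also have "2 * real k * norm (S w) \<le> 2 * (real k + 1) * norm (S w)"
      by (intro mult_right_mono) auto
    finally show "e / (4 * (real k + 1)) * norm w \<le> norm (S w)"
      by (simp add: field_simps)
  qed
qed

lemma fredholm_closed_range:
  assumes "fredholm S"
  shows "closed (range S)"
proof -
  obtain B where B: "finite B" "basis_mod (range S) B"
    using assms by (auto simp: fredholm_def cfinite_codim_def)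
  have "\<exists>z. \<exists>f\<in>cspan B. y = S z + f" for y
  proof -
    obtain F c where F: "F \<subseteq> B" "y - (\<Sum>b\<in>F. c b *\<^sub>C b) \<in> range S"
      using B(2)[unfolded basis_mod_def, THEN conjunct2, THEN spec, of y] by blast
    then obtain z where z: "y - (\<Sum>b\<in>F. c b *\<^sub>C b) = S z" by blast
    then have "y = S z + (\<Sum>b\<in>F. c b *\<^sub>C b)" by (metis diff_add_cancel)
    moreover have "(\<Sum>b\<in>F. c b *\<^sub>C b) \<in> cspan B"
      using F(1) by (intro complex_vector.span_sum complex_vector.span_scale complex_vector.span_base) auto
    ultimately show ?thesis by blast
  qed
  then obtain c where c: "c > 0" "\<And>w. w \<in> orth (cspan B) \<Longrightarrow> c * norm w \<le> norm (S w)"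
    using bounded_below_on_orth by blast
  define W where "W = blinfun_apply S ` orth (cspan B)"
  have "closed (cspan (W \<union> S ` B))"
    unfolding W_def using B(1)
    by (intro closed_cspan_finite_Un csubspace_image closed_image_bounded_below[OF _ _ c]
        normal_pair_bounded_ops csubspace_orth closed_orth) auto
  moreover have "cspan (W \<union> S ` B) = range S"
  proof
    show "cspan (W \<union> S ` B) \<subseteq> range S"
      by (intro complex_vector.span_minimal csubspace_image normal_pair_bounded_ops) (auto simp: W_def)
    show "range S \<subseteq> cspan (W \<union> S ` B)"
    proof safe
      fix x
      obtain p q where x: "x = p + q" "p \<in> cspan B" "q \<in> orth (cspan B)"
        using orth_decompose[OF complex_vector.subspace_span closed_cspan_finite[OF B(1)]] .
      have "csubspace {p. S p \<in> cspan (W \<union> S ` B)}"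
        by (auto simp: complex_vector.subspace_def blinfun.add_right
            bounded_ops_scaleC[OF normal_pair_bounded_ops]
            intro: complex_vector.span_add complex_vector.span_scale complex_vector.span_zero)
      moreover have "B \<subseteq> {p. S p \<in> cspan (W \<union> S ` B)}"
        by (auto intro: complex_vector.span_base)
      ultimately have "S p \<in> cspan (W \<union> S ` B)"
        using x(2) complex_vector.span_minimal by blast
      moreover have "S q \<in> cspan (W \<union> S ` B)"
        using x(3) by (intro complex_vector.span_base) (auto simp: W_def)
      ultimately show "S x \<in> cspan (W \<union> S ` B)"
        by (simp add: x(1) blinfun.add_right complex_vector.span_add)
    qed
  qed
  ultimately show ?thesis by simp
qed

lemma fredholm_normal_if_closed_range:
  assumes "cfinite_dim (null_space S)" "closed (range S)"
  shows "fredholm S" "fredholm_index S = 0"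
proof -
  have disj: "x = 0" if "x \<in> null_space S" "x \<in> range S" for x
    using that by (rule null_Int_range)
  have sum: "\<exists>n\<in>null_space S. x - n \<in> range S" for x
    using assms(2) by (rule closed_range_complement)
  show "fredholm S"
    by (rule fredholm_index_0_if_complementary(1)[OF normal_pair_bounded_ops assms(1) disj sum])
  show "fredholm_index S = 0"
    by (rule fredholm_index_0_if_complementary(2)[OF normal_pair_bounded_ops assms(1) disj sum])
qed

lemma fredholm_normal_index:
  assumes "fredholm S"
  shows "fredholm_index S = 0"
proof (rule fredholm_normal_if_closed_range(2))
  show "cfinite_dim (null_space S)" using assms unfolding fredholm_def by (elim conjE)
  show "closed (range S)" using assms by (rule fredholm_closed_range)
qed

end

text \<open>A closed range splits the space orthogonally into range and null space, both invariant
  under \<open>S\<close>. On the first part \<open>S\<close> is bounded below by some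
  \<open>c\<close>, on the second it vanishes, so a small nonzero shift is bounded below on
  both.\<close>

lemma shift_invertible_if_closed_range:
  fixes S S' :: "'h::complex_hilbert_space \<Rightarrow>\<^sub>L 'h"
  assumes pair: "normal_pair S S'" and cl: "closed (range S)"
  obtains c where "c > 0" "\<And>\<mu>. 0 < cmod \<mu> \<Longrightarrow> cmod \<mu> < c \<Longrightarrow> op_invertible (S - scalar_op \<mu>)"
proof -
  have "\<exists>z. \<exists>f\<in>null_space S. y = S z + f" for y
  proof -
    obtain n z where "n \<in> null_space S" "y - n = S z"
      using closed_range_complement[OF pair cl, of y] by blast
    then show ?thesis by (intro exI[of _ z] bexI[of _ n]) (simp_all add: algebra_simps)
  qed
  then obtain c where c: "c > 0" "\<And>w. w \<in> orth (null_space S) \<Longrightarrow> c * norm w \<le> norm (S w)"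
    using bounded_below_on_orth[OF pair] by blast
  have inv: "op_invertible (S - scalar_op \<mu>)" if \<mu>: "0 < cmod \<mu>" "cmod \<mu> < c" for \<mu>
  proof -
    \<comment> \<open>\<open>c - cmod \<mu>\<close> serves the range part and
      \<open>cmod \<mu>\<close> the null part; the images of the two parts stay orthogonal, so the
      smaller bound holds for the sum.\<close>
    define d where "d = min (c - cmod \<mu>) (cmod \<mu>)"
    have d: "d > 0" using \<mu> by (simp add: d_def)
    have "d * norm x \<le> norm ((S - scalar_op \<mu>) x)" for x
    proof -
      obtain q where q: "q \<in> null_space S" "x - q \<in> range S"
        using closed_range_complement[OF pair cl] by blast
      define p where "p = x - q"
      have orth0: "cinner v q = 0" if "v \<in> range S" for v
        using q(1) that unfolding orth_range[OF pair, symmetric] orth_def by blast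
      have "p \<in> orth (null_space S)"
        using q(2) unfolding p_def orth_range[OF pair, symmetric] by (auto simp: orth_def cinner_eq_0_commute)
      then have "c * norm p \<le> norm (S p)" by (rule c(2))
      also have "norm (S p) \<le> norm (S p - \<mu> *\<^sub>C p) + cmod \<mu> * norm p"
        using norm_triangle_ineq[of "S p - \<mu> *\<^sub>C p" "\<mu> *\<^sub>C p"] by (simp add: norm_scaleC)
      finally have "(c - cmod \<mu>) * norm p \<le> norm (S p - \<mu> *\<^sub>C p)" by (simp add: algebra_simps)
      moreover have "d * norm p \<le> (c - cmod \<mu>) * norm p" by (simp add: d_def mult_right_mono)
      ultimately have 1: "(d * norm p)\<^sup>2 \<le> (norm (S p - \<mu> *\<^sub>C p))\<^sup>2"
        using d by (intro power_mono) auto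
      have 2: "(d * norm q)\<^sup>2 \<le> (norm (\<mu> *\<^sub>C q))\<^sup>2"
        using d by (intro power_mono) (auto simp: norm_scaleC d_def mult_right_mono)
      have x: "x = p + q" by (simp add: p_def)
      have Sx: "(S - scalar_op \<mu>) x = (S p - \<mu> *\<^sub>C p) - \<mu> *\<^sub>C q"
        using q(1) by (simp add: x blinfun.diff_left blinfun.add_right scalar_op.rep_eq
            null_space_def scaleC_add_right)
      have "cinner p q = 0" using orth0 q(2) by (simp add: p_def)
      then have "(norm x)\<^sup>2 = (norm p)\<^sup>2 + (norm q)\<^sup>2" by (simp add: x power2_norm_add)
      moreover have "(norm ((S - scalar_op \<mu>) x))\<^sup>2 = (norm (S p - \<mu> *\<^sub>C p))\<^sup>2 + (norm (\<mu> *\<^sub>C q))\<^sup>2"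
        unfolding Sx power2_norm_diff using orth0[of "S p"] \<open>cinner p q = 0\<close>
        by (simp add: cinner_simps)
      ultimately have "(d * norm x)\<^sup>2 \<le> (norm ((S - scalar_op \<mu>) x))\<^sup>2"
        using 1 2 by (simp add: power_mult_distrib distrib_left)
      then show ?thesis by (rule power2_le_imp_le) simp
    qed
    with d show ?thesis
      by (rule normal_bounded_below_imp_invertible[OF normal_pair_shift[OF pair]])
  qed
  show thesis using that c(1) inv by blast
qed

section \<open>Isolated points of the spectrum\<close>

text \<open>Orthogonality of the characters of a cyclic group: the summands are the powers of an
  \<open>n\<close>-th root of unity \<open>z\<close>, which equals 1 only for \<open>k = l\<close>;
  otherwise the geometric sum vanishes.\<close>

lemma sum_roots_of_unity:
  fixes k l n :: nat
  assumes "k < n" "l < n"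
  defines "\<omega> \<equiv> \<lambda>j. cis (2 * pi * real j / real n)"
  shows "(\<Sum>j<n. \<omega> j ^ k * cnj (\<omega> j ^ l)) = (if k = l then of_nat n else 0)"
proof -
  define z where "z = cis (2 * pi * (real k - real l) / real n)"
  have "\<omega> j ^ k * cnj (\<omega> j ^ l) = z ^ j" for j
    unfolding \<omega>_def z_def Complex.DeMoivre cis_cnj cis_mult
    by (rule arg_cong[where f = cis]) (simp add: algebra_simps diff_divide_distrib add_divide_distrib)
  then have eq: "(\<Sum>j<n. \<omega> j ^ k * cnj (\<omega> j ^ l)) = (\<Sum>j<n. z ^ j)" by simp
  show ?thesis
  proof (cases "k = l")
    case True
    then show ?thesis unfolding eq by (simp add: z_def)
  next
    case False
    have "z ^ n = cis (2 * pi * (real k - real l))"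
      using assms(1) by (simp add: z_def Complex.DeMoivre)
    also have "\<dots> = 1"
      by (rule cis_multiple_2pi) auto
    finally have zn: "z ^ n = 1" .
    have "z \<noteq> 1"
    proof
      assume "z = 1"
      then have "cos (2 * pi * (real k - real l) / real n) = 1"
        unfolding z_def by (metis cis.sel(1) one_complex.sel(1))
      then obtain m :: int where "2 * pi * (real k - real l) / real n = real_of_int m * 2 * pi"
        unfolding cos_one_2pi_int by blast
      then have "2 * pi * (real k - real l) = 2 * pi * (real_of_int m * real n)"
        using assms(1) by (simp add: field_simps)
      then have "real k - real l = real_of_int m * real n"
        by (rule mult_left_cancel[THEN iffD1, rotated]) simp
      then have "real_of_int (int k - int l) = real_of_int (m * int n)" by simp
      then have m: "int k - int l = m * int n" by (simp only: of_int_eq_iff)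
      have "\<bar>int k - int l\<bar> < int n" using assms(1,2) by linarith
      then have "\<bar>m\<bar> * int n < 1 * int n" by (simp add: m abs_mult)
      then have "\<bar>m\<bar> < 1" by (rule mult_right_less_imp_less) simp
      then have "m = 0" by simp
      then show False using m False by simp
    qed
    then show ?thesis unfolding eq using zn False by (simp add: sum_gp_strict)
  qed
qed

text \<open>Cross terms cancel when summed over the roots of unity. Hence an upper bound valid for
  every \<open>j\<close> limits the total squared length of the \<open>v k\<close>.\<close>

lemma parseval_roots_of_unity:
  fixes v :: "nat \<Rightarrow> 'a::complex_hilbert_space" and n :: nat
  defines "\<omega> \<equiv> \<lambda>j. cis (2 * pi * real j / real n)"
  shows "(\<Sum>j<n. (norm (\<Sum>k<n. \<omega> j ^ k *\<^sub>C v k))\<^sup>2) = real n * (\<Sum>k<n. (norm (v k))\<^sup>2)"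
proof -
  have "complex_of_real (\<Sum>j<n. (norm (\<Sum>k<n. \<omega> j ^ k *\<^sub>C v k))\<^sup>2)
      = (\<Sum>j<n. \<Sum>k<n. \<Sum>l<n. (\<omega> j ^ k * cnj (\<omega> j ^ l)) * cinner (v k) (v l))"
    unfolding of_real_sum cinner_self[symmetric] cinner_sum_left
    unfolding cinner_sum_right by (simp add: cinner_simps mult_ac)
  also have "\<dots> = (\<Sum>k<n. \<Sum>l<n. (\<Sum>j<n. \<omega> j ^ k * cnj (\<omega> j ^ l)) * cinner (v k) (v l))"
    unfolding sum_distrib_right
    by (subst sum.swap, rule sum.cong[OF refl], subst sum.swap, rule refl)
  also have "\<dots> = (\<Sum>k<n. \<Sum>l<n. (if k = l then of_nat n else 0) * cinner (v k) (v l))"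
    by (intro sum.cong refl) (simp add: sum_roots_of_unity \<omega>_def del: complex_cnj_power)
  also have "\<dots> = (\<Sum>k<n. \<Sum>l<n. if l = k then of_nat n * cinner (v k) (v l) else 0)"
    by (intro sum.cong refl) auto
  also have "\<dots> = complex_of_real (real n * (\<Sum>k<n. (norm (v k))\<^sup>2))"
    by (simp add: cinner_self sum_distrib_left)
  finally show ?thesis by (simp only: of_real_eq_iff)
qed

text \<open>If \<open>S'S x\<close> is close to \<open>\<alpha>\<^sup>2 x\<close>, then \<open>S / \<alpha>\<close> is nearly isometric along the orbit \<open>w k\<close> of \<open>x\<close>.
  For \<open>\<omega>\<close> on the unit circle the vector \<open>y = (\<Sum>k<n. \<omega>\<^sup>k w k)\<close> satisfies
  \<open>norm ((S - \<alpha> cnj \<omega>) y) \<le> 3 \<alpha> norm x\<close> by telescoping, while by Parseval \<open>norm y\<close> is of order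
  \<open>sqrt n\<close> on average over the \<open>n\<close>-th roots of unity.\<close>

lemma adjoint_square_bounded_below:
  fixes S S' :: "'h::complex_hilbert_space \<Rightarrow>\<^sub>L 'h"
  assumes pair: "normal_pair S S'" and \<alpha>: "\<alpha> > 0" and c: "c > 0"
    and low: "\<And>\<mu> y. cmod \<mu> = \<alpha> \<Longrightarrow> c * norm y \<le> norm ((S - scalar_op \<mu>) y)"
  obtains \<delta> where "\<delta> > 0" "\<And>x. \<delta> * norm x \<le> norm (S' (S x) - \<alpha>\<^sup>2 *\<^sub>R x)"
proof -
  \<comment> \<open>\<open>K\<close> bounds the norm of \<open>U = S / \<alpha>\<close>; being at
    least 1 it has increasing powers, so \<open>K ^ (2 * n)\<close> dominates the earlier
    ones.\<close>
  define K where "K = max 1 (norm S / \<alpha>)"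
  have K: "K \<ge> 1" by (simp add: K_def)
  define U where "U z = (1 / \<alpha>) *\<^sub>R S z" for z
  have normU: "norm (U z) \<le> K * norm z" for z
  proof -
    have "norm (U z) = norm (S z) / \<alpha>" using \<alpha> by (simp add: U_def)
    also have "\<dots> \<le> (norm S * norm z) / \<alpha>" using \<alpha> by (intro divide_right_mono norm_blinfun) auto
    also have "\<dots> = (norm S / \<alpha>) * norm z" by simp
    also have "\<dots> \<le> K * norm z" by (intro mult_right_mono) (auto simp: K_def)
    finally show ?thesis .
  qed
  have SU: "S z = \<alpha> *\<^sub>R U z" for z using \<alpha> by (simp add: U_def)
  \<comment> \<open>This contradicts the final estimate
    \<open>c\<^sup>2 * real n \<le> 18 * \<alpha>\<^sup>2\<close>. There 9 is the square of the 3
    from telescoping, and the factor 2 comes from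
    \<open>(norm x)\<^sup>2 / 2 \<le> (norm (w k))\<^sup>2\<close>.\<close>
  obtain n :: nat where n: "18 * \<alpha>\<^sup>2 / c\<^sup>2 < real n" using reals_Archimedean2 by blast
  have n0: "n > 0" using n c \<alpha> by (metis divide_nonneg_nonneg gr0I mult_nonneg_nonneg not_less of_nat_0 zero_le_numeral zero_le_power2)
  \<comment> \<open>Chosen so that each of the \<open>n\<close> steps changes
    \<open>(norm (w k))\<^sup>2\<close> by at most \<open>(norm x)\<^sup>2 / (2 * real n)\<close>,
    hence all of them by at most half of \<open>(norm x)\<^sup>2\<close>.\<close>
  define \<delta> where "\<delta> = \<alpha>\<^sup>2 / (2 * real n * K ^ (2 * n))"
  have \<delta>: "\<delta> > 0" using \<alpha> n0 K by (simp add: \<delta>_def)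
  have "\<delta> * norm x \<le> norm (S' (S x) - \<alpha>\<^sup>2 *\<^sub>R x)" for x
  proof (rule ccontr)
    assume "\<not> ?thesis"
    then have eps: "norm (S' (S x) - \<alpha>\<^sup>2 *\<^sub>R x) \<le> \<delta> * norm x" and x0: "x \<noteq> 0" by auto
    define w where "w k = (U ^^ k) x" for k
    define D where "D z = S' (S z) - \<alpha>\<^sup>2 *\<^sub>R z" for z
    have w0: "w 0 = x" and wS: "w (Suc k) = U (w k)" for k by (simp_all add: w_def)
    \<comment> \<open>By normality the defect \<open>D\<close> commutes with \<open>U\<close>, so
      its smallness at \<open>x\<close> propagates along the orbit at the cost of a factor
      \<open>K ^ k\<close>.\<close>
    have DU: "D (U z) = U (D z)" for z
      by (simp add: D_def U_def blinfun.scaleR_right blinfun.diff_right scaleR_diff_right mult.commute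
          normal_pair_commute[OF pair])
    have norm_w: "norm (w k) \<le> K ^ k * norm x" for k
    proof (induction k)
      case (Suc k)
      have "norm (w (Suc k)) \<le> K * norm (w k)" unfolding wS by (rule normU)
      also have "\<dots> \<le> K * (K ^ k * norm x)" using Suc K by (intro mult_left_mono) auto
      finally show ?case by (simp add: mult.assoc)
    qed (simp add: w0)
    have norm_D: "norm (D (w k)) \<le> K ^ k * (\<delta> * norm x)" for k
    proof (induction k)
      case 0
      then show ?case using eps by (simp add: D_def w0)
    next
      case (Suc k)
      have "norm (D (w (Suc k))) \<le> K * norm (D (w k))" unfolding wS DU by (rule normU)
      also have "\<dots> \<le> K * (K ^ k * (\<delta> * norm x))" using Suc K by (intro mult_left_mono) auto
      finally show ?case by (simp add: mult.assoc)
    qed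
    have step: "\<bar>(norm (w (Suc k)))\<^sup>2 - (norm (w k))\<^sup>2\<bar> \<le> (norm x)\<^sup>2 / (2 * real n)" if "k < n" for k
    proof -
      have "(norm (S (w k)))\<^sup>2 = Re (cinner (S' (S (w k))) (w k))"
        by (simp add: power2_norm_eq_cinner normal_pair_cinner'[OF pair])
      also have "\<dots> = Re (cinner (D (w k)) (w k)) + \<alpha>\<^sup>2 * (norm (w k))\<^sup>2"
        by (simp add: D_def cinner_simps power2_norm_eq_cinner)
      finally have "(norm (w (Suc k)))\<^sup>2 - (norm (w k))\<^sup>2 = Re (cinner (D (w k)) (w k)) / \<alpha>\<^sup>2"
        using \<alpha> by (simp add: wS U_def power_divide field_simps)
      also have "\<bar>\<dots>\<bar> \<le> norm (D (w k)) * norm (w k) / \<alpha>\<^sup>2"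
        using abs_Re_le_cmod[of "cinner (D (w k)) (w k)"] norm_cinner_le[of "D (w k)" "w k"]
        by (simp add: abs_divide divide_right_mono)
      also have "\<dots> \<le> (K ^ k * (\<delta> * norm x)) * (K ^ k * norm x) / \<alpha>\<^sup>2"
        using norm_D norm_w K \<delta> by (intro divide_right_mono mult_mono) auto
      also have "\<dots> = K ^ (2 * k) * (\<delta> * (norm x)\<^sup>2 / \<alpha>\<^sup>2)"
        by (simp add: power2_eq_square power_mult mult_ac)
      also have "\<dots> \<le> K ^ (2 * n) * (\<delta> * (norm x)\<^sup>2 / \<alpha>\<^sup>2)"
        using that K \<delta> by (intro mult_right_mono power_increasing) auto
      also have "\<dots> = (norm x)\<^sup>2 / (2 * real n)"
        using K \<alpha> n0 by (simp add: \<delta>_def)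
      finally show ?thesis .
    qed
    have near: "\<bar>(norm (w k))\<^sup>2 - (norm x)\<^sup>2\<bar> \<le> real k * ((norm x)\<^sup>2 / (2 * real n))" if "k \<le> n" for k
      using that
    proof (induction k)
      case (Suc k)
      have eq: "real (Suc k) * a = real k * a + a" for a by (simp add: distrib_right)
      have "k \<le> n" "k < n" using Suc.prems by auto
      from Suc.IH[OF this(1)] step[OF this(2)] show ?case unfolding eq by linarith
    qed (simp add: w0)
    have near': "\<bar>(norm (w k))\<^sup>2 - (norm x)\<^sup>2\<bar> \<le> (norm x)\<^sup>2 / 2" if "k \<le> n" for k
    proof -
      have "real k * ((norm x)\<^sup>2 / (2 * real n)) \<le> real n * ((norm x)\<^sup>2 / (2 * real n))"
        using that by (intro mult_right_mono) auto
      also have "\<dots> = (norm x)\<^sup>2 / 2" using n0 by simp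
      finally show ?thesis using near[OF that] by linarith
    qed
    have "(norm (w n))\<^sup>2 \<le> (2 * norm x)\<^sup>2"
    proof -
      have "(norm (w n))\<^sup>2 \<le> 4 * (norm x)\<^sup>2"
        using near'[OF order_refl] zero_le_power2[of "norm x"] by linarith
      then show ?thesis by simp
    qed
    then have wn: "norm (w n) \<le> 2 * norm x" by (rule power2_le_imp_le) simp
    define \<omega> where "\<omega> = (\<lambda>j. cis (2 * pi * real j / real n))"
    define y where "y j = (\<Sum>k<n. \<omega> j ^ k *\<^sub>C w k)" for j
    have y_le: "c\<^sup>2 * (norm (y j))\<^sup>2 \<le> 9 * \<alpha>\<^sup>2 * (norm x)\<^sup>2" for j
    proof -
      let ?\<mu> = "complex_of_real \<alpha> * cnj (\<omega> j)"
      have om: "cnj (\<omega> j) * \<omega> j = 1" by (simp add: \<omega>_def cis_cnj cis_mult)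
      have S_C: "S (a *\<^sub>C z) = a *\<^sub>C S z" for a z
        by (rule bounded_ops_scaleC[OF normal_pair_bounded_ops[OF pair]])
      \<comment> \<open>\<open>S\<close> sends \<open>w k\<close> to \<open>\<alpha>\<close> times
        \<open>w (Suc k)\<close>; raising the exponent of \<open>\<omega> j\<close> by one is
        compensated by \<open>cnj (\<omega> j)\<close>, its inverse.\<close>
      have *: "\<omega> j ^ k *\<^sub>C S (w k) - ?\<mu> *\<^sub>C (\<omega> j ^ k *\<^sub>C w k)
          = ?\<mu> *\<^sub>C (\<omega> j ^ Suc k *\<^sub>C w (Suc k) - \<omega> j ^ k *\<^sub>C w k)" for k
      proof -
        have "\<omega> j ^ k *\<^sub>C S (w k) = (\<omega> j ^ k * of_real \<alpha>) *\<^sub>C w (Suc k)"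
          unfolding SU[of "w k"] wS by (simp flip: scaleC_of_real add: scaleC_scaleC)
        also have "\<omega> j ^ k * of_real \<alpha> = ?\<mu> * \<omega> j ^ Suc k"
          using om by (simp add: mult_ac)
        finally show ?thesis
          by (simp add: complex_vector.scale_right_diff_distrib scaleC_scaleC)
      qed
      have "(S - scalar_op ?\<mu>) (y j) = (\<Sum>k<n. \<omega> j ^ k *\<^sub>C S (w k) - ?\<mu> *\<^sub>C (\<omega> j ^ k *\<^sub>C w k))"
        by (simp add: y_def blinfun.diff_left blinfun.sum_right scalar_op.rep_eq S_C
            complex_vector.scale_sum_right sum_subtractf)
      also have "\<dots> = ?\<mu> *\<^sub>C (\<Sum>k<n. \<omega> j ^ Suc k *\<^sub>C w (Suc k) - \<omega> j ^ k *\<^sub>C w k)"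
        unfolding * complex_vector.scale_sum_right ..
      also have "\<dots> = ?\<mu> *\<^sub>C (\<omega> j ^ n *\<^sub>C w n - x)"
        unfolding sum_lessThan_telescope[of "\<lambda>k. \<omega> j ^ k *\<^sub>C w k"]
        by (simp add: w0 scaleC_one)
      finally have "norm ((S - scalar_op ?\<mu>) (y j)) = \<alpha> * norm (\<omega> j ^ n *\<^sub>C w n - x)"
        using \<alpha> by (simp add: norm_scaleC norm_mult \<omega>_def)
      also have "\<dots> \<le> \<alpha> * (norm (w n) + norm x)"
        using norm_triangle_ineq4[of "\<omega> j ^ n *\<^sub>C w n" x] \<alpha>
        by (simp add: norm_scaleC norm_power \<omega>_def)
      also have "\<dots> \<le> \<alpha> * (3 * norm x)" using wn \<alpha> by simp
      finally have "norm ((S - scalar_op ?\<mu>) (y j)) \<le> 3 * \<alpha> * norm x" by simp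
      moreover have "c * norm (y j) \<le> norm ((S - scalar_op ?\<mu>) (y j))"
        using \<alpha> by (intro low) (simp add: norm_mult \<omega>_def)
      ultimately have "(c * norm (y j))\<^sup>2 \<le> (3 * \<alpha> * norm x)\<^sup>2"
        using c by (intro power_mono) auto
      then show ?thesis by (simp add: power_mult_distrib)
    qed
    have "real n * ((norm x)\<^sup>2 / 2) = (\<Sum>k<n. (norm x)\<^sup>2 / 2)" by simp
    also have "\<dots> \<le> (\<Sum>k<n. (norm (w k))\<^sup>2)"
    proof (rule sum_mono)
      fix k assume "k \<in> {..<n}"
      then have "k \<le> n" by simp
      from near'[OF this] show "(norm x)\<^sup>2 / 2 \<le> (norm (w k))\<^sup>2" by linarith
    qed
    finally have "c\<^sup>2 * (real n * (real n * ((norm x)\<^sup>2 / 2))) \<le> c\<^sup>2 * (real n * (\<Sum>k<n. (norm (w k))\<^sup>2))"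
      by (intro mult_left_mono) auto
    also have "\<dots> = (\<Sum>j<n. c\<^sup>2 * (norm (y j))\<^sup>2)"
      unfolding y_def \<omega>_def parseval_roots_of_unity[symmetric] by (simp add: sum_distrib_left)
    also have "\<dots> \<le> (\<Sum>j<n. 9 * \<alpha>\<^sup>2 * (norm x)\<^sup>2)" by (intro sum_mono y_le)
    also have "\<dots> = real n * (9 * \<alpha>\<^sup>2 * (norm x)\<^sup>2)" by simp
    finally have "(real n * (norm x)\<^sup>2) * (c\<^sup>2 * real n) \<le> (real n * (norm x)\<^sup>2) * (18 * \<alpha>\<^sup>2)"
      by (simp add: algebra_simps)
    then have "c\<^sup>2 * real n \<le> 18 * \<alpha>\<^sup>2"
      using n0 x0 by (subst (asm) mult_le_cancel_left_pos) auto
    then show False using n c by (simp add: field_simps)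
  qed
  with \<delta> show thesis by (rule that)
qed

text \<open>The optimal lower bound \<open>m\<close> of a symmetric operator \<open>B = A - t\<close> is attained in the sense that
  \<open>B\<^sup>2 - m\<^sup>2 = (A - (t - m)) (A - (t + m))\<close> is not bounded below: otherwise the positive operator
  \<open>B\<^sup>2 - m\<^sup>2\<close> would have strictly positive lower form bound.\<close>

lemma symmetric_gap_bound:
  fixes A :: "'h::complex_hilbert_space \<Rightarrow>\<^sub>L 'h"
  assumes sym: "\<And>x y. Re (cinner (A x) y) = Re (cinner x (A y))" and t: "t > 0"
    and gap: "\<And>s. 0 < s \<Longrightarrow> s < 2 * t \<Longrightarrow> \<exists>\<delta>>0. \<forall>x. \<delta> * norm x \<le> norm (A x - s *\<^sub>R x)"
  shows "t * norm x \<le> norm (A x - t *\<^sub>R x)"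
proof -
  define B where "B z = A z - t *\<^sub>R z" for z
  \<comment> \<open>Bounds are capped at the target \<open>t\<close>; a supremum \<open>m\<close>
    below \<open>t\<close> leaves \<open>t - m\<close> and \<open>t + m\<close> strictly inside the
    gap.\<close>
  define M where "M = {m. 0 \<le> m \<and> m \<le> t \<and> (\<forall>x. m * norm x \<le> norm (B x))}"
  have B_sym: "Re (cinner (B x) y) = Re (cinner x (B y))" for x y
    by (simp add: B_def cinner_simps sym)
  define m where "m = Sup M"
  have M0: "0 \<in> M" using t by (simp add: M_def)
  have bdd: "bdd_above M" by (rule bdd_aboveI[of _ t]) (simp add: M_def)
  have m_upper: "m' \<le> m" if "m' \<in> M" for m' unfolding m_def using that bdd by (rule cSup_upper)
  have "m \<in> M"
    unfolding M_def
  proof (intro CollectI conjI allI)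
    show "0 \<le> m" using m_upper[OF M0] .
    show "m \<le> t" unfolding m_def using M0 by (intro cSup_least) (auto simp: M_def)
    show "m * norm x \<le> norm (B x)" for x
    proof (cases "x = 0")
      case False
      have "m \<le> norm (B x) / norm x"
        unfolding m_def using M0 False by (intro cSup_least) (auto simp: M_def pos_le_divide_eq)
      then show ?thesis using False by (simp add: pos_le_divide_eq)
    qed simp
  qed
  then have m: "0 \<le> m" "m \<le> t" "\<And>x. m * norm x \<le> norm (B x)" by (auto simp: M_def)
  have "m = t"
  proof (rule ccontr)
    assume "m \<noteq> t"
    then have mt: "m < t" using m(2) by simp
    obtain d1 where d1: "d1 > 0" "\<And>x. d1 * norm x \<le> norm (A x - (t - m) *\<^sub>R x)"
      using gap[of "t - m"] mt m(1) t by auto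
    obtain d2 where d2: "d2 > 0" "\<And>x. d2 * norm x \<le> norm (A x - (t + m) *\<^sub>R x)"
      using gap[of "t + m"] mt m(1) t by auto
    define C where "C z = B (B z) - m\<^sup>2 *\<^sub>R z" for z
    define d where "d = d1 * d2"
    have d: "d > 0" using d1 d2 by (simp add: d_def)
    have C_low: "d * norm z \<le> norm (C z)" for z
    proof -
      define y where "y = A z - (t + m) *\<^sub>R z"
      have "C z = A y - (t - m) *\<^sub>R y"
        by (simp add: C_def B_def y_def blinfun.diff_right blinfun.scaleR_right blinfun.add_right
            algebra_simps power2_eq_square)
      then have "d1 * norm y \<le> norm (C z)" using d1(2)[of y] by simp
      moreover have "d1 * (d2 * norm z) \<le> d1 * norm y"
        using d1(1) d2(2)[of z] by (simp add: y_def)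
      ultimately show ?thesis by (simp add: d_def)
    qed
    have lin: "bounded_linear C"
      unfolding C_def B_def
      by (intro bounded_linear_intros blinfun.bounded_linear_right
          bounded_linear_compose[OF blinfun.bounded_linear_right])
    then obtain K where K: "K > 0" "\<And>z. norm (C z) \<le> norm z * K"
      using bounded_linear.pos_bounded by blast
    have form: "Re (cinner (C z) z) = (norm (B z))\<^sup>2 - m\<^sup>2 * (norm z)\<^sup>2" for z
      using B_sym[of "B z" z] by (simp add: C_def cinner_simps power2_norm_eq_cinner)
    have form_ge: "Re (cinner (C z) z) \<ge> 0" for z
      using power_mono[OF m(3)[of z], of 2] m(1) by (simp add: form power_mult_distrib)
    have C_sym: "Re (cinner (C x) y) = Re (cinner x (C y))" for x y
      by (simp add: C_def cinner_simps B_sym)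
    \<comment> \<open>Positivity of the form at \<open>z - (1 / K) *\<^sub>R u\<close> with
      \<open>u = C z\<close> yields \<open>(norm u)\<^sup>2 \<le> K * Re (cinner (C z) z)\<close>.
      The coefficient \<open>1 / K\<close> is optimal once the form at \<open>u\<close> is replaced
      by its bound \<open>K * (norm u)\<^sup>2\<close>.\<close>
    have low: "(d\<^sup>2 / K) * (norm z)\<^sup>2 \<le> Re (cinner (C z) z)" for z
    proof -
      define u where "u = C z"
      have "0 \<le> Re (cinner (C (z - (1 / K) *\<^sub>R u)) (z - (1 / K) *\<^sub>R u))" by (rule form_ge)
      also have "Re (cinner (C (z - a *\<^sub>R u)) (z - a *\<^sub>R u))
          = Re (cinner (C z) z) - 2 * a * (norm u)\<^sup>2 + a\<^sup>2 * Re (cinner (C u) u)" for a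
        using C_sym[of u z]
        by (simp add: linear_diff[OF bounded_linear.linear[OF lin]] power2_eq_square[of a]
            linear_scale[OF bounded_linear.linear[OF lin]] cinner_simps power2_norm_eq_cinner
            u_def algebra_simps)
      also have "Re (cinner (C u) u) \<le> K * (norm u)\<^sup>2"
      proof -
        have "Re (cinner (C u) u) \<le> norm (C u) * norm u"
          using complex_Re_le_cmod norm_cinner_le order_trans by blast
        also have "\<dots> \<le> (norm u * K) * norm u" by (intro mult_right_mono K) auto
        finally show ?thesis by (simp add: power2_eq_square mult_ac)
      qed
      also have "(1 / K)\<^sup>2 * (K * (norm u)\<^sup>2) = (1 / K) * (norm u)\<^sup>2"
        using K(1) by (simp add: power2_eq_square)
      finally have "(1 / K) * (norm u)\<^sup>2 \<le> Re (cinner (C z) z)"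
        using K(1) by (simp add: mult_left_mono)
      moreover have "(1 / K) * (d * norm z)\<^sup>2 \<le> (1 / K) * (norm u)\<^sup>2"
        using C_low[of z] d K(1) by (intro mult_left_mono power_mono) (auto simp: u_def)
      ultimately show ?thesis by (simp add: power_mult_distrib)
    qed
    \<comment> \<open>The form bound improves \<open>m\<^sup>2\<close> to
      \<open>m\<^sup>2 + d\<^sup>2 / K\<close>; the minimum with \<open>t\<close> keeps
      \<open>m'\<close> in \<open>M\<close>, against the choice of \<open>m\<close>.\<close>
    define m' where "m' = min t (sqrt (m\<^sup>2 + d\<^sup>2 / K))"
    have "m < sqrt (m\<^sup>2 + d\<^sup>2 / K)"
      using d K(1) m(1) by (intro real_less_rsqrt) simp
    then have "m < m'" using mt by (simp add: m'_def)
    have "m' * norm z \<le> norm (B z)" for z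
    proof (rule power2_le_imp_le)
      have "m'\<^sup>2 \<le> (sqrt (m\<^sup>2 + d\<^sup>2 / K))\<^sup>2"
        using \<open>m < m'\<close> m(1) K(1) by (intro power_mono) (auto simp: m'_def)
      also have "\<dots> = m\<^sup>2 + d\<^sup>2 / K" using K(1) by (intro real_sqrt_pow2) auto
      finally have "m'\<^sup>2 * (norm z)\<^sup>2 \<le> (m\<^sup>2 + d\<^sup>2 / K) * (norm z)\<^sup>2"
        by (rule mult_right_mono) simp
      also have "\<dots> \<le> (norm (B z))\<^sup>2" using low[of z] by (simp add: form algebra_simps)
      finally show "(m' * norm z)\<^sup>2 \<le> (norm (B z))\<^sup>2" by (simp add: power_mult_distrib)
    qed simp
    then have "m' \<in> M" using \<open>m < m'\<close> m(1) by (simp add: M_def) (simp add: m'_def)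
    then show False using m_upper \<open>m < m'\<close> by fastforce
  qed
  then show ?thesis using m(3)[of x] by (simp add: B_def)
qed

text \<open>A lower bound \<open>c \<mu>\<close> survives, halved, on the disc of radius
  \<open>c \<mu> / 2\<close> around \<open>\<mu>\<close>; finitely many such discs cover
  \<open>C\<close>.\<close>

lemma shift_bounded_below_compact:
  fixes S :: "'h::complex_hilbert_space \<Rightarrow>\<^sub>L 'h"
  assumes "compact C" and inv: "\<And>\<mu>. \<mu> \<in> C \<Longrightarrow> op_invertible (S - scalar_op \<mu>)"
  obtains c where "c > 0" "\<And>\<mu> y. \<mu> \<in> C \<Longrightarrow> c * norm y \<le> norm ((S - scalar_op \<mu>) y)"
proof -
  have "\<exists>c>0. \<forall>y. c * norm y \<le> norm ((S - scalar_op \<mu>) y)" if "\<mu> \<in> C" for \<mu>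
    using op_invertible_imp_bounded_below[OF inv[OF that]] by blast
  then obtain c where c: "\<And>\<mu>. \<mu> \<in> C \<Longrightarrow> c \<mu> > 0"
    "\<And>\<mu> y. \<mu> \<in> C \<Longrightarrow> c \<mu> * norm y \<le> norm ((S - scalar_op \<mu>) y)" by metis
  have "C \<subseteq> (\<Union>\<mu>\<in>C. ball \<mu> (c \<mu> / 2))" using c(1) by force
  then obtain D where D: "D \<subseteq> C" "finite D" "C \<subseteq> (\<Union>\<mu>\<in>D. ball \<mu> (c \<mu> / 2))"
    using compactE_image[OF assms(1), of C "\<lambda>\<mu>. ball \<mu> (c \<mu> / 2)"] by auto
  \<comment> \<open>\<open>insert 1\<close> takes care of an empty \<open>C\<close>, for which
    \<open>D\<close> is empty.\<close>
  define e where "e = Min (insert 1 ((\<lambda>\<mu>. c \<mu> / 2) ` D))"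
  have e0: "e > 0" unfolding e_def using D(1,2) c(1) by (auto simp: subset_iff)
  have "e * norm y \<le> norm ((S - scalar_op \<nu>) y)" if \<nu>: "\<nu> \<in> C" for \<nu> y
  proof -
    obtain \<mu> where \<mu>: "\<mu> \<in> D" "dist \<mu> \<nu> < c \<mu> / 2" using D(3) \<nu> by auto
    have "e \<le> c \<mu> / 2" unfolding e_def using D(2) \<mu>(1) by (intro Min_le) auto
    then have "e * norm y \<le> (c \<mu> / 2) * norm y" by (rule mult_right_mono) simp
    moreover have "cmod (\<nu> - \<mu>) * norm y \<le> (c \<mu> / 2) * norm y"
      using \<mu>(2) by (intro mult_right_mono) (auto simp: dist_norm norm_minus_commute)
    moreover have "c \<mu> * norm y \<le> norm ((S - scalar_op \<mu>) y)" using c(2) \<mu>(1) D(1) by blast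
    moreover have "norm ((S - scalar_op \<mu>) y) \<le> norm ((S - scalar_op \<nu>) y) + cmod (\<nu> - \<mu>) * norm y"
    proof -
      have "(S - scalar_op \<mu>) y = (S - scalar_op \<nu>) y + (\<nu> - \<mu>) *\<^sub>C y"
        by (simp add: blinfun.diff_left scalar_op.rep_eq complex_vector.scale_left_diff_distrib)
      then show ?thesis
        using norm_triangle_ineq[of "(S - scalar_op \<nu>) y" "(\<nu> - \<mu>) *\<^sub>C y"] by (simp add: norm_scaleC)
    qed
    ultimately show ?thesis by (simp add: field_simps)
  qed
  with e0 show thesis by (rule that)
qed

lemma csubspace_closure:
  fixes V :: "'a::complex_hilbert_space set"
  assumes V: "csubspace V"
  shows "csubspace (closure V)"
  unfolding complex_vector.subspace_def
proof (intro conjI ballI allI)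
  show "0 \<in> closure V" using complex_vector.subspace_0[OF V] closure_subset by blast
  fix x y assume x: "x \<in> closure V" and y: "y \<in> closure V"
  obtain f g where "\<And>n. f n \<in> V" "f \<longlonglongrightarrow> x" "\<And>n. g n \<in> V" "g \<longlonglongrightarrow> y"
    using x y unfolding closure_sequential by blast
  then show "x + y \<in> closure V"
    unfolding closure_sequential
    by (intro exI[of _ "\<lambda>n. f n + g n"]) (auto intro: tendsto_add complex_vector.subspace_add[OF V])
next
  fix a x assume x: "x \<in> closure V"
  obtain f where "\<And>n. f n \<in> V" "f \<longlonglongrightarrow> x" using x unfolding closure_sequential by blast
  moreover have "(\<lambda>n. a *\<^sub>C f n) \<longlonglongrightarrow> a *\<^sub>C x"
    using bounded_linear.tendsto[OF blinfun.bounded_linear_right[of "scalar_op a"] \<open>f \<longlonglongrightarrow> x\<close>]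
    by (simp add: scalar_op.rep_eq)
  ultimately show "a *\<^sub>C x \<in> closure V"
    unfolding closure_sequential
    by (intro exI[of _ "\<lambda>n. a *\<^sub>C f n"]) (auto intro: complex_vector.subspace_scale[OF V])
qed

lemma closed_range_if_isolated:
  fixes S S' :: "'h::complex_hilbert_space \<Rightarrow>\<^sub>L 'h"
  assumes pair: "normal_pair S S'" and r: "r > 0"
    and inv: "\<And>\<mu>. 0 < cmod \<mu> \<Longrightarrow> cmod \<mu> < r \<Longrightarrow> op_invertible (S - scalar_op \<mu>)"
  shows "closed (range S)"
proof -
  \<comment> \<open>Centre and half-length of the gap between 0 and \<open>r\<^sup>2\<close> in the
    spectrum of \<open>S' o\<^sub>L S\<close>.\<close>
  define t where "t = r\<^sup>2 / 2"
  have t: "t > 0" using r by (simp add: t_def)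
  have gap: "\<exists>\<delta>>0. \<forall>x. \<delta> * norm x \<le> norm ((S' o\<^sub>L S) x - s *\<^sub>R x)" if s: "0 < s" "s < 2 * t" for s
  proof -
    have \<alpha>: "0 < sqrt s" "sqrt s < r"
      using s r real_less_lsqrt[of r s] by (simp_all add: t_def)
    obtain c where "c > 0" "\<And>\<mu> y. \<mu> \<in> sphere 0 (sqrt s) \<Longrightarrow> c * norm y \<le> norm ((S - scalar_op \<mu>) y)"
    proof (rule shift_bounded_below_compact[of "sphere 0 (sqrt s)" S])
      show "op_invertible (S - scalar_op \<mu>)" if "\<mu> \<in> sphere 0 (sqrt s)" for \<mu>
        using \<alpha> that by (intro inv) auto
    qed auto
    then obtain \<delta> where "\<delta> > 0" "\<And>x. \<delta> * norm x \<le> norm (S' (S x) - (sqrt s)\<^sup>2 *\<^sub>R x)"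
      using adjoint_square_bounded_below[OF pair \<alpha>(1), of c] by auto
    then show ?thesis using s by auto
  qed
  have "Re (cinner ((S' o\<^sub>L S) x) y) = Re (cinner x ((S' o\<^sub>L S) y))" for x y
    by (simp add: normal_pair_cinner'[OF pair] normal_pair_cinner[OF pair])
  from symmetric_gap_bound[OF this t gap]
  have low: "t * norm x \<le> norm (S' (S x) - t *\<^sub>R x)" for x by simp
  \<comment> \<open>When \<open>low\<close> is squared and expanded, the terms
    \<open>(t * norm x)\<^sup>2\<close> cancel and \<open>(norm (S x))\<^sup>2\<close> keeps the
    coefficient \<open>2 * t = r\<^sup>2\<close>; normality replaces \<open>S' (S x)\<close> by
    \<open>S (S x)\<close> under the norm.\<close>
  have range_low: "r * norm (S x) \<le> norm (S (S x))" for x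
  proof (rule power2_le_imp_le)
    have "(t * norm x)\<^sup>2 \<le> (norm (S' (S x) - t *\<^sub>R x))\<^sup>2"
      using t by (intro power_mono low) auto
    also have "\<dots> = (norm (S (S x)))\<^sup>2 - 2 * t * (norm (S x))\<^sup>2 + (t * norm x)\<^sup>2"
      using t unfolding power2_norm_diff
      by (simp add: normal_pair_norm[OF pair] cinner_simps normal_pair_cinner'[OF pair]
          power2_norm_eq_cinner power_mult_distrib)
    finally show "(r * norm (S x))\<^sup>2 \<le> (norm (S (S x)))\<^sup>2"
      by (simp add: t_def power_mult_distrib)
  qed simp
  define V where "V = closure (range S)"
  have sub: "csubspace V" unfolding V_def
    by (intro csubspace_closure csubspace_image normal_pair_bounded_ops[OF pair]) simp
  have "range S \<subseteq> {v. r * norm v \<le> norm (S v)}" using range_low by auto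
  moreover have "closed {v. r * norm v \<le> norm (S v)}"
    by (intro closed_Collect_le continuous_intros)
  ultimately have V_low: "r * norm v \<le> norm (S v)" if "v \<in> V" for v
    using that closure_minimal unfolding V_def by blast
  have "range S = S ` V"
  proof
    show "range S \<subseteq> S ` V"
    proof safe
      fix x
      obtain p q where x: "x = p + q" "p \<in> V" "q \<in> orth V"
        using orth_decompose[OF sub] unfolding V_def by blast
      have "q \<in> orth (range S)" using x(3) closure_subset[of "range S"] unfolding orth_def V_def by blast
      then have "S q = 0" unfolding orth_range[OF pair] null_space_def by simp
      then show "S x \<in> S ` V" using x by (simp add: blinfun.add_right)
    qed
  qed auto
  moreover have "closed (S ` V)"
    by (rule closed_image_bounded_below[OF sub _ r V_low]) (simp add: V_def)
  ultimately show ?thesis by simp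
qed

section \<open>Weyl's theorem for families\<close>

text \<open>A single function on operators: inverting a family is composition with it, and
  continuity can be settled without reference to \<open>X\<close>.\<close>

definition op_inverse :: "('h::complex_hilbert_space \<Rightarrow>\<^sub>L 'h) \<Rightarrow> 'h \<Rightarrow>\<^sub>L 'h"
  where "op_inverse S = (SOME G. G \<in> bounded_ops \<and> S o\<^sub>L G = id_blinfun \<and> G o\<^sub>L S = id_blinfun)"

lemma op_inverse:
  assumes "op_invertible S"
  shows "op_inverse S \<in> bounded_ops" "S o\<^sub>L op_inverse S = id_blinfun" "op_inverse S o\<^sub>L S = id_blinfun"
proof -
  have "\<exists>G. G \<in> bounded_ops \<and> S o\<^sub>L G = id_blinfun \<and> G o\<^sub>L S = id_blinfun"
    using assms by (auto simp: op_invertible_def)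
  from someI_ex[OF this]
  show "op_inverse S \<in> bounded_ops" "S o\<^sub>L op_inverse S = id_blinfun" "op_inverse S o\<^sub>L S = id_blinfun"
    unfolding op_inverse_def by auto
qed

lemma continuous_on_op_inverse:
  "continuous_on {S :: 'h::complex_hilbert_space \<Rightarrow>\<^sub>L 'h. op_invertible S} op_inverse"
  unfolding continuous_on_iff
proof (intro ballI allI impI)
  fix A :: "'h \<Rightarrow>\<^sub>L 'h" and e :: real
  assume "A \<in> {S. op_invertible S}" and e: "e > 0"
  then have A: "op_invertible A" by simp
  obtain c where c: "c > 0" "\<And>x. c * norm x \<le> norm (A x)"
    using op_invertible_imp_bounded_below[OF A] by blast
  \<comment> \<open>Within \<open>c / 2\<close> of \<open>A\<close> the lower bound
    \<open>c / 2\<close> persists, so the inverses have norm at most \<open>2 / c\<close> and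
    \<open>1 / c\<close>. Their difference factors through \<open>A - B\<close>, which explains the
    second radius.\<close>
  have "dist (op_inverse B) (op_inverse A) < e"
    if "op_invertible B" and d: "dist B A < min (c / 2) (e * c\<^sup>2 / 2)" for B
  proof -
    have nB: "norm (A - B) < c / 2" "norm (A - B) < e * c\<^sup>2 / 2"
      using d by (auto simp: dist_norm norm_minus_commute)
    have "c / 2 * norm x \<le> norm (B x)" for x
    proof -
      have "norm (A x) \<le> norm (B x) + norm ((A - B) x)"
        using norm_triangle_ineq[of "B x" "(A - B) x"] by (simp add: blinfun.diff_left)
      also have "norm ((A - B) x) \<le> norm (A - B) * norm x" by (rule norm_blinfun)
      also have "\<dots> \<le> c / 2 * norm x" using nB(1) by (intro mult_right_mono) auto
      finally have "norm (A x) \<le> norm (B x) + c / 2 * norm x" by simp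
      then show ?thesis using c(2)[of x] by (simp add: field_simps)
    qed
    then have iB: "norm (op_inverse B) \<le> 1 / (c / 2)"
      using c(1) op_inverse(2)[OF that(1)] by (intro norm_inverse_le[of "c / 2" B]) auto
    have iA: "norm (op_inverse A) \<le> 1 / c"
      using norm_inverse_le[OF c op_inverse(2)[OF A]] .
    have AA: "A (op_inverse A x) = x" for x
      using arg_cong[OF op_inverse(2)[OF A], of "\<lambda>T. blinfun_apply T x"] by simp
    have BB: "op_inverse B (B x) = x" for x
      using arg_cong[OF op_inverse(3)[OF that(1)], of "\<lambda>T. blinfun_apply T x"] by simp
    have "op_inverse B - op_inverse A = op_inverse B o\<^sub>L ((A - B) o\<^sub>L op_inverse A)"
      by (rule blinfun_eqI) (simp add: blinfun.diff_left blinfun.diff_right AA BB)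
    also have "norm \<dots> \<le> norm (op_inverse B) * norm ((A - B) o\<^sub>L op_inverse A)"
      by (rule norm_blinfun_compose)
    also have "\<dots> \<le> norm (op_inverse B) * (norm (A - B) * norm (op_inverse A))"
      by (intro mult_left_mono norm_blinfun_compose) auto
    also have "\<dots> \<le> 1 / (c / 2) * (norm (A - B) * (1 / c))"
      using iA iB c(1) by (intro mult_mono mult_left_mono) auto
    also have "\<dots> < e" using nB(2) c(1) by (simp add: field_simps power2_eq_square)
    finally show ?thesis by (simp add: dist_norm)
  qed
  moreover have "min (c / 2) (e * c\<^sup>2 / 2) > 0" using c(1) e by simp
  ultimately show "\<exists>d>0. \<forall>B\<in>{S. op_invertible S}. dist B A < d \<longrightarrow> dist (op_inverse B) (op_inverse A) < e"
    by (metis mem_Collect_eq)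
qed

lemma family_invertible_iff:
  assumes S: "S \<in> op_families X"
  shows "family_invertible X S \<longleftrightarrow> (\<forall>x\<in>topspace X. op_invertible (S x))"
proof
  assume "family_invertible X S"
  then obtain G where G: "G \<in> op_families X"
    "\<forall>x\<in>topspace X. S x o\<^sub>L G x = id_blinfun \<and> G x o\<^sub>L S x = id_blinfun"
    unfolding family_invertible_def by blast
  have "G x \<in> bounded_ops" if "x \<in> topspace X" for x
    using G(1) that unfolding op_families_def continuous_map_in_subtopology by auto
  with G(2) show "\<forall>x\<in>topspace X. op_invertible (S x)" unfolding op_invertible_def by blast
next
  assume inv: "\<forall>x\<in>topspace X. op_invertible (S x)"
  have "continuous_map X (top_of_set {A. op_invertible A}) S"
    using S inv unfolding op_families_def continuous_map_in_subtopology by auto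
  moreover have "continuous_map (top_of_set {A. op_invertible A}) euclidean op_inverse"
    using continuous_on_op_inverse by simp
  ultimately have "continuous_map X euclidean (op_inverse \<circ> S)" by (rule continuous_map_compose)
  then have "op_inverse \<circ> S \<in> op_families X"
    unfolding op_families_def continuous_map_in_subtopology using inv by (auto simp: op_inverse)
  then show "family_invertible X S"
    unfolding family_invertible_def using inv by (intro bexI[of _ "op_inverse \<circ> S"]) (auto simp: op_inverse)
qed

lemma family_shift_in_op_families:
  assumes "T \<in> op_families X"
  shows "family_shift T \<mu> \<in> op_families X"
  using assms unfolding op_families_def continuous_map_in_subtopology family_shift_def
  by (auto intro!: continuous_map_diff bounded_ops_diff scalar_op_in_bounded_ops)

text \<open>Normality makes every pointwise index 0. The entry at a component is a definite
  description, and its uniqueness uses that components are nonempty.\<close>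

lemma weyl_family_normal_iff:
  assumes S: "S \<in> op_families X" and pair: "\<And>x. x \<in> topspace X \<Longrightarrow> \<exists>S'. normal_pair (S x) S'"
  shows "weyl_family X S \<longleftrightarrow> (\<forall>x\<in>topspace X. fredholm (S x))"
proof
  assume fred: "\<forall>x\<in>topspace X. fredholm (S x)"
  have "(THE n. \<forall>x\<in>C. fredholm_index (S x) = n) = 0" if C: "C \<in> connected_components_of X" for C
  proof (rule the_equality)
    have sub: "C \<subseteq> topspace X" using C by (rule connected_components_of_subset)
    show zero: "\<forall>x\<in>C. fredholm_index (S x) = 0"
      using sub fred pair fredholm_normal_index by blast
    show "n = 0" if "\<forall>x\<in>C. fredholm_index (S x) = n" for n
      using that zero nonempty_connected_components_of[OF C] by auto
  qed
  then have "family_index X S = (\<lambda>C\<in>connected_components_of X. 0)"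
    unfolding family_index_def by (intro restrict_ext)
  then show "weyl_family X S" using S fred by (simp add: weyl_family_def fredholm_family_def)
qed (simp add: weyl_family_def fredholm_family_def)

section \<open>Fredholm shifts of a single normal operator\<close>

lemma op_invertible_normal_imp_fredholm:
  assumes pair: "normal_pair S S'" and inv: "op_invertible S"
  shows "fredholm S"
proof -
  obtain c where c: "c > 0" "\<And>x. c * norm x \<le> norm (S x)"
    using op_invertible_imp_bounded_below[OF inv] by blast
  have "closed (range S)"
    by (rule closed_image_bounded_below[OF complex_vector.subspace_UNIV closed_UNIV c])
  moreover have "null_space S \<subseteq> {0}"
  proof
    fix x assume "x \<in> null_space S"
    then have "c * norm x \<le> 0" using c(2)[of x] by (simp add: null_space_def)
    then show "x \<in> {0}" using c(1) by (simp add: mult_le_0_iff)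
  qed
  then have "cfinite_dim (null_space S)"
    unfolding cfinite_dim_def by (intro exI[of _ "{}"]) simp
  ultimately show ?thesis by (intro fredholm_normal_if_closed_range(1)[OF pair])
qed

lemma scalar_op_diff_diff: "T - scalar_op \<mu> - scalar_op (\<nu> - \<mu>) = T - scalar_op \<nu>"
  by (rule blinfun_eqI)
    (simp add: blinfun.diff_left scalar_op.rep_eq complex_vector.scale_left_diff_distrib)

lemma op_E0_imp_fredholm:
  assumes pair: "normal_pair (T - scalar_op \<mu>) S'" and E0: "\<mu> \<in> op_E0 T"
  shows "fredholm (T - scalar_op \<mu>)"
proof -
  obtain e where e: "e > 0" "\<And>\<nu>. \<nu> \<in> op_spectrum T \<Longrightarrow> dist \<mu> \<nu> < e \<Longrightarrow> \<nu> = \<mu>"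
    using E0 unfolding op_E0_def isolated_in_dist_Ex_iff by blast
  have "op_invertible (T - scalar_op \<mu> - scalar_op \<rho>)" if "0 < cmod \<rho>" "cmod \<rho> < e" for \<rho>
  proof -
    have "T - scalar_op \<mu> - scalar_op \<rho> = T - scalar_op (\<mu> + \<rho>)"
      using scalar_op_diff_diff[of T \<mu> "\<mu> + \<rho>"] by (simp only: add_diff_cancel_left')
    moreover have "\<mu> + \<rho> \<notin> op_spectrum T"
      using e(2)[of "\<mu> + \<rho>"] that by (auto simp: dist_norm)
    ultimately show ?thesis by (simp only: op_spectrum_def mem_Collect_eq not_not)
  qed
  then have "closed (range (T - scalar_op \<mu>))" by (rule closed_range_if_isolated[OF pair e(1)])
  moreover have "cfinite_dim (null_space (T - scalar_op \<mu>))" using E0 by (simp add: op_E0_def)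
  ultimately show ?thesis by (intro fredholm_normal_if_closed_range(1)[OF pair])
qed

lemma fredholm_imp_op_E0:
  assumes pair: "normal_pair (T - scalar_op \<mu>) S'" and fred: "fredholm (T - scalar_op \<mu>)"
    and spec: "\<mu> \<in> op_spectrum T"
  shows "\<mu> \<in> op_E0 T"
proof -
  let ?S = "T - scalar_op \<mu>"
  have cl: "closed (range ?S)" by (rule fredholm_closed_range[OF pair fred])
  obtain c where c: "c > 0" "\<And>\<rho>. 0 < cmod \<rho> \<Longrightarrow> cmod \<rho> < c \<Longrightarrow> op_invertible (?S - scalar_op \<rho>)"
    using shift_invertible_if_closed_range[OF pair cl] by blast
  have "\<nu> = \<mu>" if "\<nu> \<in> op_spectrum T" "dist \<mu> \<nu> < c" for \<nu>
    using that c(2)[of "\<nu> - \<mu>"]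
    by (auto simp: op_spectrum_def scalar_op_diff_diff dist_norm norm_minus_commute)
  then have "\<mu> isolated_in op_spectrum T"
    using spec c(1) unfolding isolated_in_dist_Ex_iff by blast
  \<comment> \<open>With a trivial null space the closed range would be everything, and
    \<open>bounded_below_on_orth\<close> for \<open>F = {0}\<close> would bound \<open>?S\<close>
    below on all of \<open>orth {0}\<close>, the whole space.\<close>
  moreover have "null_space ?S \<noteq> {0}"
  proof
    assume null: "null_space ?S = {0}"
    have "\<exists>z. \<exists>f\<in>{0}. y = ?S z + f" for y
      using closed_range_complement[OF pair cl, of y] unfolding null by auto
    then obtain b where "b > 0" "\<And>w. w \<in> orth {0} \<Longrightarrow> b * norm w \<le> norm (?S w)"
      using bounded_below_on_orth[OF pair] by blast
    then have "op_invertible ?S"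
      by (intro normal_bounded_below_imp_invertible[OF pair]) (auto simp: orth_def)
    then show False using spec by (simp add: op_spectrum_def)
  qed
  moreover have "cfinite_dim (null_space ?S)" using fred by (simp add: fredholm_def)
  ultimately show ?thesis by (simp add: op_E0_def)
qed

theorem theorem3p7:
  fixes X :: "'x topology"
    and T :: "'x \<Rightarrow> 'h::complex_hilbert_space \<Rightarrow>\<^sub>L 'h"
  assumes "\<not> cfinite_dim (UNIV :: 'h set)"
    and "separable_space (euclidean :: 'h topology)"
    and "countable (connected_components_of X)"
    and "T \<in> op_families X"
    and "\<And>x. x \<in> topspace X \<Longrightarrow> normal_op (T x)"
  shows "weyl_spectrum X T = family_spectrum X T - family_E0 X T"
proof (rule set_eqI)
  fix \<mu>
  have pair: "\<exists>S'. normal_pair (T x - scalar_op \<mu>) S'" if "x \<in> topspace X" for x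
    using normal_pair_shift[OF normal_op_imp_normal_pair[OF assms(5)[OF that]]] by blast
  note fam = family_shift_in_op_families[OF assms(4), of \<mu>]
  have weyl: "\<mu> \<in> weyl_spectrum X T \<longleftrightarrow> (\<exists>x\<in>topspace X. \<not> fredholm (T x - scalar_op \<mu>))"
    using weyl_family_normal_iff[OF fam] pair by (simp add: weyl_spectrum_def family_shift_def)
  have spec: "\<mu> \<in> family_spectrum X T \<longleftrightarrow> (\<exists>x\<in>topspace X. \<mu> \<in> op_spectrum (T x))"
    using family_invertible_iff[OF fam] by (simp add: family_spectrum_def family_shift_def op_spectrum_def)
  have fred: "fredholm (T x - scalar_op \<mu>) \<longleftrightarrow> (\<mu> \<in> op_spectrum (T x) \<longrightarrow> \<mu> \<in> op_E0 (T x))"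
    if "x \<in> topspace X" for x
    using pair[OF that] op_invertible_normal_imp_fredholm op_E0_imp_fredholm fredholm_imp_op_E0
    unfolding op_spectrum_def[of "T x"] mem_Collect_eq by (metis (no_types) CollectI op_spectrum_def)
  \<comment> \<open>The set \<open>A\<close> in \<open>family_E0\<close> is forced: it must contain
    each \<open>x\<close> with \<open>\<mu>\<close> in the spectrum of \<open>T x\<close>, and no
    other, since \<open>op_E0\<close> lies in the spectrum.\<close>
  have E0: "\<mu> \<in> family_E0 X T \<longleftrightarrow> \<mu> \<in> family_spectrum X T \<and>
      (\<forall>x\<in>topspace X. \<mu> \<in> op_spectrum (T x) \<longrightarrow> \<mu> \<in> op_E0 (T x))"
  proof (intro iffI conjI)
    assume spec': "\<mu> \<in> family_spectrum X T \<and>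
      (\<forall>x\<in>topspace X. \<mu> \<in> op_spectrum (T x) \<longrightarrow> \<mu> \<in> op_E0 (T x))"
    let ?A = "{x \<in> topspace X. \<mu> \<in> op_spectrum (T x)}"
    have "?A \<noteq> {}" using spec' spec by blast
    with spec' show "\<mu> \<in> family_E0 X T"
      unfolding family_E0_def by (intro CollectI conjI exI[of _ ?A]) auto
  qed (auto simp: family_E0_def)
  show "\<mu> \<in> weyl_spectrum X T \<longleftrightarrow> \<mu> \<in> family_spectrum X T - family_E0 X T"
    using weyl spec fred E0 by blast
qed

end
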